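(* Let $X$ be a locally compact and separable metric space with Borel $\sigma$-algebra $\mathcal{B}$, and let $\mu : \mathcal{B} \to [0,\infty]$ be a Borel measure such that $\mu(O) > 0$ for all non-empty open sets $O \subset X$ and $\mu(K) < \infty$ for all compact sets $K \subset X$. Let $V \subset L^2(X,\mu)$ be a regular Dirichlet space which embeds (continuously and) densely into $L^1(X,\mu)$, and let $$M := \{ v \in L^\infty(X,\mu) \mid -1 \le v \le 1 \ \mu\text{-a.e. in } X \},$$ considered as a subset of the dual space $V^\star$. Assume that a tuple $(q,y) \in M \times V$ is given such that $y \in \mathcal{N}_M(q) \subset V^{\star\star} \cong V$ and such that there exists an open set $O \subset X$ with $\mu(O \cap \{y = 0\}) = 0$ and $\operatorname{cap}(O \cap \{y = 0\}) > 0$. Then $M \subset V^\star$ is not polyhedric at $q$ with respect to $y$.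
   Context: All function spaces are real. Dirichlet spaces: a subspace $V \subset L^2(X,\mu)$ is called a Dirichlet space if there exists a symmetric bilinear form $\mathcal{E} : V \times V \to \mathbb{R}$ such that (a) $V$ is dense in $L^2(X,\mu)$ and $\mathcal{E}(u,u) \ge 0$ for all $u \in V$; (b) $V$ is a Hilbert space when endowed with the inner product $\mathcal{E}_1(\cdot,\cdot) = \mathcal{E}(\cdot,\cdot) + (\cdot,\cdot)_{L^2}$; (c) for all $u \in V$ it holds $v := \min(1,\max(0,u)) \in V$ and $\mathcal{E}(v,v) \le \mathcal{E}(u,u)$. It is called regular if $V \cap C_c(X)$ is dense in $V$ with respect to the norm induced by $\mathcal{E}_1$ and $V \cap C_c(X)$ is dense in $C_c(X)$ with respect to the supremum norm, where $C_c(X)$ denotes the continuous functions with compact support. Capacity: for $A \subset X$, $\operatorname{cap}(A) := \inf\{ \mathcal{E}_1(u,u) \mid u \in V,\ u \ge 1 \ \mu\text{-a.e. on an open neighborhood of } A \}$ (with $\inf \emptyset = \infty$). A function $u : X \to \mathbb{R}$ is quasi-continuous if for every $\varepsilon > 0$ there is an open set $G \subset X$ with $\operatorname{cap}(G) < \varepsilon$ and $u|_{X\setminus G} \in C(X \setminus G)$. Every $v \in V$ has a quasi-continuous representative, unique up to sets of capacity zero; sets such as $\{y=0\}$ are always understood with respect to the (Borel measurable) quasi-continuous representative. Identification: since $V$ is continuously and densely embedded into $L^1(X,\mu)$, each $v \in L^\infty(X,\mu)$ is identified with the functional $u \mapsto \int_X v\,u\,\mathrm{d}\mu$ in $V^\star$.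 The set $M$ is convex, non-empty and closed in $V^\star$. Polyhedricity: for a closed, convex, non-empty subset $K$ of a Banach space $W$ and $w \in K$, let $\mathcal{R}_K(w) := \mathbb{R}^+(K - w)$, $\mathcal{T}_K(w) := \overline{\mathcal{R}_K(w)}$ (closure in $W$) and $\mathcal{N}_K(w) := \mathcal{T}_K(w)^\circ = \{\eta \in W^\star \mid \langle \eta, h\rangle \le 0 \ \forall h \in \mathcal{T}_K(w)\}$ be the radial, tangent and normal cone. For $\eta \in W^\star$ let $\eta^\perp \subset W$ denote the kernel of $\eta$. $K$ is polyhedric at $w \in K$ with respect to $\eta \in \mathcal{N}_K(w)$ if $\mathcal{T}_K(w) \cap \eta^\perp = \overline{\mathcal{R}_K(w) \cap \eta^\perp}$. Here this is applied with $W = V^\star$ and $W^\star = V^{\star\star} \cong V$. *)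

theory Defs
  imports "HOL-Analysis.Analysis"
begin

section \<open>Polyhedricity in normed spaces of real functions\<close>

text \<open>
  A normed space is given by a carrier \<open>W\<close> of real-valued functions, closed under the pointwise
  vector space operations, and a norm \<open>N\<close> on it. The dual of such a space is again a set of
  real-valued functions (on functions), so the construction can be iterated. Functionals are
  required to vanish outside \<open>W\<close>, so that two functionals agreeing on \<open>W\<close> are equal.
  \<open>N\<close> may be a seminorm whose kernel consists of the functions that vanish almost everywhere;
  a functional bounded with respect to it depends on almost-everywhere classes only.
\<close>

definition dual_space :: "('b \<Rightarrow> real) set \<Rightarrow> (('b \<Rightarrow> real) \<Rightarrow> real) \<Rightarrow> (('b \<Rightarrow> real) \<Rightarrow> real) set"
  where "dual_space W N = {\<phi>.
     (\<forall>f\<in>W. \<forall>g\<in>W. \<phi> (\<lambda>x. f x + g x) = \<phi> f + \<phi> g) \<and>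
     (\<forall>c. \<forall>f\<in>W. \<phi> (\<lambda>x. c * f x) = c * \<phi> f) \<and>
     (\<exists>C. \<forall>f\<in>W. \<bar>\<phi> f\<bar> \<le> C * N f) \<and>
     (\<forall>f. f \<notin> W \<longrightarrow> \<phi> f = 0)}"

definition dual_norm :: "('b \<Rightarrow> real) set \<Rightarrow> (('b \<Rightarrow> real) \<Rightarrow> real) \<Rightarrow> (('b \<Rightarrow> real) \<Rightarrow> real) \<Rightarrow> real"
  where "dual_norm W N \<phi> = (SUP f\<in>{f\<in>W. N f \<le> 1}. \<bar>\<phi> f\<bar>)"

definition bidual_embedding ::
  "('b \<Rightarrow> real) set \<Rightarrow> (('b \<Rightarrow> real) \<Rightarrow> real) \<Rightarrow> ('b \<Rightarrow> real) \<Rightarrow> (('b \<Rightarrow> real) \<Rightarrow> real) \<Rightarrow> real"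
  where "bidual_embedding W N f = (\<lambda>\<phi>. if \<phi> \<in> dual_space W N then \<phi> f else 0)"

definition closure_in :: "('b \<Rightarrow> real) set \<Rightarrow> (('b \<Rightarrow> real) \<Rightarrow> real) \<Rightarrow> ('b \<Rightarrow> real) set \<Rightarrow> ('b \<Rightarrow> real) set"
  where "closure_in W N A = {w\<in>W. \<forall>\<epsilon>>0. \<exists>a\<in>A. N (\<lambda>x. w x - a x) < \<epsilon>}"

definition radial_cone :: "('b \<Rightarrow> real) set \<Rightarrow> ('b \<Rightarrow> real) \<Rightarrow> ('b \<Rightarrow> real) set"
  where "radial_cone K w = {(\<lambda>x. t * (k x - w x)) | t k. t > 0 \<and> k \<in> K}"

definition tangent_cone ::
  "('b \<Rightarrow> real) set \<Rightarrow> (('b \<Rightarrow> real) \<Rightarrow> real) \<Rightarrow> ('b \<Rightarrow> real) set \<Rightarrow> ('b \<Rightarrow> real) \<Rightarrow> ('b \<Rightarrow> real) set"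
  where "tangent_cone W N K w = closure_in W N (radial_cone K w)"

definition normal_cone ::
  "('b \<Rightarrow> real) set \<Rightarrow> (('b \<Rightarrow> real) \<Rightarrow> real) \<Rightarrow> ('b \<Rightarrow> real) set \<Rightarrow> ('b \<Rightarrow> real)
    \<Rightarrow> (('b \<Rightarrow> real) \<Rightarrow> real) set"
  where "normal_cone W N K w = {\<eta> \<in> dual_space W N. \<forall>h\<in>tangent_cone W N K w. \<eta> h \<le> 0}"

definition annihilator :: "('b \<Rightarrow> real) set \<Rightarrow> (('b \<Rightarrow> real) \<Rightarrow> real) \<Rightarrow> ('b \<Rightarrow> real) set"
  where "annihilator W \<eta> = {w\<in>W. \<eta> w = 0}"

text \<open>Meant for \<open>K\<close> closed, convex and non-empty, \<open>w \<in> K\<close> and \<open>\<eta> \<in> normal_cone W N K w\<close>.\<close>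

definition polyhedric_at ::
  "('b \<Rightarrow> real) set \<Rightarrow> (('b \<Rightarrow> real) \<Rightarrow> real) \<Rightarrow> ('b \<Rightarrow> real) set \<Rightarrow> ('b \<Rightarrow> real)
    \<Rightarrow> (('b \<Rightarrow> real) \<Rightarrow> real) \<Rightarrow> bool"
  where "polyhedric_at W N K w \<eta> \<longleftrightarrow>
     tangent_cone W N K w \<inter> annihilator W \<eta> =
     closure_in W N (radial_cone K w \<inter> annihilator W \<eta>)"


section \<open>Dirichlet spaces\<close>

text \<open>
  Elements of Lebesgue spaces are measurable functions; subspaces of them are represented by sets
  of functions that are closed under almost-everywhere equality.
\<close>

definition L1 :: "'a measure \<Rightarrow> ('a \<Rightarrow> real) set"
  where "L1 \<mu> = {u. integrable \<mu> u}"

definition L2 :: "'a measure \<Rightarrow> ('a \<Rightarrow> real) set"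
  where "L2 \<mu> = {u \<in> borel_measurable \<mu>. integrable \<mu> (\<lambda>x. (u x)\<^sup>2)}"

definition Linf :: "'a measure \<Rightarrow> ('a \<Rightarrow> real) set"
  where "Linf \<mu> = {u \<in> borel_measurable \<mu>. \<exists>C. AE x in \<mu>. \<bar>u x\<bar> \<le> C}"

definition L1_norm :: "'a measure \<Rightarrow> ('a \<Rightarrow> real) \<Rightarrow> real"
  where "L1_norm \<mu> u = (\<integral>x. \<bar>u x\<bar> \<partial>\<mu>)"

definition L2_inner :: "'a measure \<Rightarrow> ('a \<Rightarrow> real) \<Rightarrow> ('a \<Rightarrow> real) \<Rightarrow> real"
  where "L2_inner \<mu> u v = (\<integral>x. u x * v x \<partial>\<mu>)"

definition L2_norm :: "'a measure \<Rightarrow> ('a \<Rightarrow> real) \<Rightarrow> real"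
  where "L2_norm \<mu> u = sqrt (L2_inner \<mu> u u)"

definition E1 :: "'a measure \<Rightarrow> (('a \<Rightarrow> real) \<Rightarrow> ('a \<Rightarrow> real) \<Rightarrow> real)
    \<Rightarrow> ('a \<Rightarrow> real) \<Rightarrow> ('a \<Rightarrow> real) \<Rightarrow> real"
  where "E1 \<mu> E u v = E u v + L2_inner \<mu> u v"

definition E1_norm :: "'a measure \<Rightarrow> (('a \<Rightarrow> real) \<Rightarrow> ('a \<Rightarrow> real) \<Rightarrow> real) \<Rightarrow> ('a \<Rightarrow> real) \<Rightarrow> real"
  where "E1_norm \<mu> E u = sqrt (E1 \<mu> E u u)"

definition Cc :: "('a::topological_space \<Rightarrow> real) set"
  where "Cc = {f. continuous_on UNIV f \<and> compact (closure {x. f x \<noteq> 0})}"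

text \<open>
  The values of \<open>E\<close> outside \<open>V\<close> are irrelevant. Assumption \<open>E_AE\<close> says that \<open>E\<close> is well defined on
  almost-everywhere classes. Definiteness of \<open>E1\<close> on classes is automatic because \<open>E\<close> is
  nonnegative, so being a Hilbert space amounts to the completeness assumption.
\<close>

locale dirichlet_space =
  fixes \<mu> :: "'a measure"
    and V :: "('a \<Rightarrow> real) set"
    and E :: "('a \<Rightarrow> real) \<Rightarrow> ('a \<Rightarrow> real) \<Rightarrow> real"
  assumes V_L2: "V \<subseteq> L2 \<mu>"
    and V_AE: "u \<in> V \<Longrightarrow> v \<in> borel_measurable \<mu> \<Longrightarrow> AE x in \<mu>. u x = v x \<Longrightarrow> v \<in> V"
    and V_zero: "(\<lambda>x. 0) \<in> V"
    and V_add: "u \<in> V \<Longrightarrow> v \<in> V \<Longrightarrow> (\<lambda>x. u x + v x) \<in> V"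
    and V_scale: "u \<in> V \<Longrightarrow> (\<lambda>x. c * u x) \<in> V"
    and E_AE: "u \<in> V \<Longrightarrow> v \<in> V \<Longrightarrow> w \<in> V \<Longrightarrow> AE x in \<mu>. u x = v x \<Longrightarrow> E u w = E v w"
    and E_sym: "u \<in> V \<Longrightarrow> v \<in> V \<Longrightarrow> E u v = E v u"
    and E_add: "u \<in> V \<Longrightarrow> v \<in> V \<Longrightarrow> w \<in> V \<Longrightarrow> E (\<lambda>x. u x + v x) w = E u w + E v w"
    and E_scale: "u \<in> V \<Longrightarrow> w \<in> V \<Longrightarrow> E (\<lambda>x. c * u x) w = c * E u w"
    and E_nonneg: "u \<in> V \<Longrightarrow> E u u \<ge> 0"
    and V_dense_L2: "f \<in> L2 \<mu> \<Longrightarrow> \<epsilon> > 0 \<Longrightarrow> \<exists>u\<in>V. L2_norm \<mu> (\<lambda>x. f x - u x) < \<epsilon>"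
    and V_complete:
      "(\<And>n::nat. s n \<in> V) \<Longrightarrow>
       (\<And>\<epsilon>. \<epsilon> > 0 \<Longrightarrow> \<exists>n0. \<forall>m\<ge>n0. \<forall>n\<ge>n0. E1_norm \<mu> E (\<lambda>x. s m x - s n x) < \<epsilon>) \<Longrightarrow>
       \<exists>u\<in>V. (\<lambda>n. E1_norm \<mu> E (\<lambda>x. s n x - u x)) \<longlonglongrightarrow> 0"
    and E_contraction:
      "u \<in> V \<Longrightarrow> (\<lambda>x. min 1 (max 0 (u x))) \<in> V \<and>
         E (\<lambda>x. min 1 (max 0 (u x))) (\<lambda>x. min 1 (max 0 (u x))) \<le> E u u"

locale regular_dirichlet_space = dirichlet_space \<mu> V E
  for \<mu> :: "'a::topological_space measure"
    and V :: "('a \<Rightarrow> real) set"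
    and E :: "('a \<Rightarrow> real) \<Rightarrow> ('a \<Rightarrow> real) \<Rightarrow> real" +
  assumes dense_in_V:
      "u \<in> V \<Longrightarrow> \<epsilon> > 0 \<Longrightarrow> \<exists>g\<in>V \<inter> Cc. E1_norm \<mu> E (\<lambda>x. u x - g x) < \<epsilon>"
    and dense_in_Cc:
      "f \<in> Cc \<Longrightarrow> \<epsilon> > 0 \<Longrightarrow> \<exists>g\<in>V \<inter> Cc. \<forall>x. \<bar>f x - g x\<bar> < \<epsilon>"

definition embeds_continuously_densely_L1 ::
  "'a measure \<Rightarrow> ('a \<Rightarrow> real) set \<Rightarrow> (('a \<Rightarrow> real) \<Rightarrow> ('a \<Rightarrow> real) \<Rightarrow> real) \<Rightarrow> bool"
  where "embeds_continuously_densely_L1 \<mu> V E \<longleftrightarrow>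
     V \<subseteq> L1 \<mu> \<and>
     (\<exists>C. \<forall>u\<in>V. L1_norm \<mu> u \<le> C * E1_norm \<mu> E u) \<and>
     (\<forall>f\<in>L1 \<mu>. \<forall>\<epsilon>>0. \<exists>u\<in>V. L1_norm \<mu> (\<lambda>x. f x - u x) < \<epsilon>)"


section \<open>Capacity and quasi-continuity\<close>

definition capacity ::
  "'a::topological_space measure \<Rightarrow> ('a \<Rightarrow> real) set \<Rightarrow> (('a \<Rightarrow> real) \<Rightarrow> ('a \<Rightarrow> real) \<Rightarrow> real)
    \<Rightarrow> 'a set \<Rightarrow> ennreal"
  where "capacity \<mu> V E A =
     Inf {ennreal (E1 \<mu> E u u) | u. u \<in> V \<and>
            (\<exists>G. open G \<and> A \<subseteq> G \<and> (AE x in \<mu>. x \<in> G \<longrightarrow> u x \<ge> 1))}"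

definition quasi_continuous ::
  "'a::topological_space measure \<Rightarrow> ('a \<Rightarrow> real) set \<Rightarrow> (('a \<Rightarrow> real) \<Rightarrow> ('a \<Rightarrow> real) \<Rightarrow> real)
    \<Rightarrow> ('a \<Rightarrow> real) \<Rightarrow> bool"
  where "quasi_continuous \<mu> V E u \<longleftrightarrow>
     (\<forall>\<epsilon>::real. \<epsilon> > 0 \<longrightarrow> (\<exists>G. open G \<and> capacity \<mu> V E G < ennreal \<epsilon> \<and> continuous_on (- G) u))"

definition quasi_continuous_rep ::
  "'a::topological_space measure \<Rightarrow> ('a \<Rightarrow> real) set \<Rightarrow> (('a \<Rightarrow> real) \<Rightarrow> ('a \<Rightarrow> real) \<Rightarrow> real)
    \<Rightarrow> ('a \<Rightarrow> real) \<Rightarrow> ('a \<Rightarrow> real) \<Rightarrow> bool"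
  where "quasi_continuous_rep \<mu> V E u v \<longleftrightarrow>
     v \<in> borel_measurable borel \<and> (AE x in \<mu>. v x = u x) \<and> quasi_continuous \<mu> V E v"


section \<open>The dual of a Dirichlet space and the unit ball of essentially bounded functions\<close>

definition V_dual ::
  "'a measure \<Rightarrow> ('a \<Rightarrow> real) set \<Rightarrow> (('a \<Rightarrow> real) \<Rightarrow> ('a \<Rightarrow> real) \<Rightarrow> real)
    \<Rightarrow> (('a \<Rightarrow> real) \<Rightarrow> real) set"
  where "V_dual \<mu> V E = dual_space V (E1_norm \<mu> E)"

definition V_dual_norm ::
  "'a measure \<Rightarrow> ('a \<Rightarrow> real) set \<Rightarrow> (('a \<Rightarrow> real) \<Rightarrow> ('a \<Rightarrow> real) \<Rightarrow> real)
    \<Rightarrow> (('a \<Rightarrow> real) \<Rightarrow> real) \<Rightarrow> real"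
  where "V_dual_norm \<mu> V E = dual_norm V (E1_norm \<mu> E)"

definition functional_of ::
  "'a measure \<Rightarrow> ('a \<Rightarrow> real) set \<Rightarrow> ('a \<Rightarrow> real) \<Rightarrow> ('a \<Rightarrow> real) \<Rightarrow> real"
  where "functional_of \<mu> V v = (\<lambda>u. if u \<in> V then (\<integral>x. v x * u x \<partial>\<mu>) else 0)"

definition M_set :: "'a measure \<Rightarrow> ('a \<Rightarrow> real) set"
  where "M_set \<mu> = {v \<in> Linf \<mu>. AE x in \<mu>. -1 \<le> v x \<and> v x \<le> 1}"

definition M_dual :: "'a measure \<Rightarrow> ('a \<Rightarrow> real) set \<Rightarrow> (('a \<Rightarrow> real) \<Rightarrow> real) set"
  where "M_dual \<mu> V = functional_of \<mu> V ` M_set \<mu>"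

end

theory Submission
  imports Defs
begin

text \<open>
  Let \<open>N\<close> be the normal cone of \<open>M\<close> at \<open>q\<close>, seen in \<open>V\<close>: the functions \<open>z\<close> with \<open>q z = \<bar>z\<bar>\<close> a.e.
  An element of the radial cone that is annihilated by \<open>y\<close> vanishes a.e. where \<open>y \<noteq> 0\<close>, hence on \<open>U\<close>.
  If \<open>M\<close> were polyhedric at \<open>q\<close> with respect to \<open>y\<close>, then every tangent direction annihilated by
  \<open>y\<close> would vanish on all \<open>u\<close> supported in \<open>U\<close>, and the bipolar theorem would put every such \<open>u\<close>,
  together with \<open>- u\<close>, into the closure of \<open>{z - t y | z \<in> N, t \<ge> 0}\<close>. But on \<open>U\<close> all \<open>z \<in> N\<close> share the
  sign of \<open>y\<close>, so \<open>u\<close> and \<open>- u\<close> cannot both be approximated near \<open>{y = 0}\<close> unless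
  \<open>{y = 0} \<inter> {u > c}\<close> has capacity zero. Covering \<open>U\<close> by countably many sets \<open>{u > c}\<close> yields
  that \<open>U \<inter> {y = 0}\<close> has capacity zero.
\<close>

section \<open>Cones and duality in semi-Hilbert spaces\<close>

text \<open>\<open>B\<close> is only semidefinite because functions are not identified when they
  agree almost everywhere: for \<open>E1 \<mu> E\<close>, two versions of one class have distance
  zero.\<close>

locale semi_hilbert_space =
  fixes V :: "('b \<Rightarrow> real) set" and B :: "('b \<Rightarrow> real) \<Rightarrow> ('b \<Rightarrow> real) \<Rightarrow> real"
  assumes zero_mem: "(\<lambda>x. 0) \<in> V"
    and add_mem: "u \<in> V \<Longrightarrow> v \<in> V \<Longrightarrow> (\<lambda>x. u x + v x) \<in> V"
    and scale_mem: "u \<in> V \<Longrightarrow> (\<lambda>x. c * u x) \<in> V"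
    and B_sym: "u \<in> V \<Longrightarrow> v \<in> V \<Longrightarrow> B u v = B v u"
    and B_add: "u \<in> V \<Longrightarrow> v \<in> V \<Longrightarrow> w \<in> V \<Longrightarrow> B (\<lambda>x. u x + v x) w = B u w + B v w"
    and B_scale: "u \<in> V \<Longrightarrow> w \<in> V \<Longrightarrow> B (\<lambda>x. c * u x) w = c * B u w"
    and B_nonneg: "u \<in> V \<Longrightarrow> 0 \<le> B u u"
    and complete:
      "(\<And>n::nat. s n \<in> V) \<Longrightarrow>
       (\<And>\<epsilon>. \<epsilon> > 0 \<Longrightarrow> \<exists>n0. \<forall>m\<ge>n0. \<forall>n\<ge>n0. sqrt (B (\<lambda>x. s m x - s n x) (\<lambda>x. s m x - s n x)) < \<epsilon>) \<Longrightarrow>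
       \<exists>u\<in>V. (\<lambda>n. sqrt (B (\<lambda>x. s n x - u x) (\<lambda>x. s n x - u x))) \<longlonglongrightarrow> 0"
begin

section \<open>Algebra of the form and its seminorm\<close>

definition nrm :: "('b \<Rightarrow> real) \<Rightarrow> real"
  where "nrm u = sqrt (B u u)"

lemma diff_mem: "u \<in> V \<Longrightarrow> v \<in> V \<Longrightarrow> (\<lambda>x. u x - v x) \<in> V"
  using add_mem[of u "\<lambda>x. (-1) * v x"] scale_mem[of v "-1"] by simp

lemma minus_mem: "u \<in> V \<Longrightarrow> (\<lambda>x. - u x) \<in> V"
  using scale_mem[of u "-1"] by simp

lemma B_diff:
  assumes "u \<in> V" "v \<in> V" "w \<in> V"
  shows "B (\<lambda>x. u x - v x) w = B u w - B v w"
  using B_add[OF assms(1) scale_mem[OF assms(2), of "-1"] assms(3)] B_scale[OF assms(2,3), of "-1"]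
  by simp

lemma B_add_right: "u \<in> V \<Longrightarrow> v \<in> V \<Longrightarrow> w \<in> V \<Longrightarrow> B w (\<lambda>x. u x + v x) = B w u + B w v"
  using B_add[of u v w] B_sym[of w] add_mem[of u v] by simp

lemma B_diff_right: "u \<in> V \<Longrightarrow> v \<in> V \<Longrightarrow> w \<in> V \<Longrightarrow> B w (\<lambda>x. u x - v x) = B w u - B w v"
  using B_diff[of u v w] B_sym[of w] diff_mem[of u v] by simp

lemma B_scale_right: "u \<in> V \<Longrightarrow> w \<in> V \<Longrightarrow> B w (\<lambda>x. c * u x) = c * B w u"
  using B_scale[of u w c] B_sym[of w] scale_mem[of u c] by simp

lemma B_minus_right: "u \<in> V \<Longrightarrow> w \<in> V \<Longrightarrow> B w (\<lambda>x. - u x) = - B w u"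
  using B_scale_right[of u w "-1"] by simp

lemma B_zero: "w \<in> V \<Longrightarrow> B (\<lambda>x. 0) w = 0"
  using B_scale[OF zero_mem, of w 0] by simp

lemma nrm_sq: "u \<in> V \<Longrightarrow> (nrm u)\<^sup>2 = B u u"
  by (simp add: nrm_def B_nonneg)

lemma nrm_nonneg: "u \<in> V \<Longrightarrow> 0 \<le> nrm u"
  by (simp add: nrm_def B_nonneg)

lemma nrm_scale: "u \<in> V \<Longrightarrow> nrm (\<lambda>x. c * u x) = \<bar>c\<bar> * nrm u"
  by (simp add: nrm_def B_scale B_scale_right scale_mem real_sqrt_mult flip: mult.assoc)

lemma nrm_diff_commute:
  assumes "u \<in> V" "v \<in> V"
  shows "nrm (\<lambda>x. u x - v x) = nrm (\<lambda>x. v x - u x)"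
  using nrm_scale[OF diff_mem[OF assms], of "-1"] by simp

lemma B_add_scale_square:
  assumes "u \<in> V" "v \<in> V"
  shows "B (\<lambda>x. u x + t * v x) (\<lambda>x. u x + t * v x) = B u u + 2 * t * B u v + t\<^sup>2 * B v v"
  using assms by (simp add: B_add B_add_right B_scale B_scale_right add_mem scale_mem
      B_sym[of v u] power2_eq_square algebra_simps)

text \<open>The quadratic polynomial \<open>t \<mapsto> B (u + t v) (u + t v)\<close> is
  nonnegative. Semidefiniteness forces a separate treatment of \<open>B v v = 0\<close>, where the
  polynomial is affine and its slope has to vanish.\<close>

lemma cauchy_schwarz:
  assumes u: "u \<in> V" and v: "v \<in> V"
  shows "\<bar>B u v\<bar> \<le> nrm u * nrm v"
proof -
  have q: "0 \<le> B u u + 2 * t * B u v + t\<^sup>2 * B v v" for t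
    using B_nonneg[OF add_mem[OF u scale_mem[OF v]]] B_add_scale_square[OF u v] by simp
  have "(B u v)\<^sup>2 \<le> B u u * B v v"
  proof (cases "B v v = 0")
    case True
    have "B u v = 0"
    proof (rule ccontr)
      assume nz: "B u v \<noteq> 0"
      \<comment> \<open>At this \<open>t\<close> the polynomial takes the value
        \<open>-1\<close>.\<close>
      show False
        using q[of "- (B u u + 1) / (2 * B u v)"] nz B_nonneg[OF u] True by (simp add: field_simps)
    qed
    then show ?thesis using True by simp
  next
    case False
    then have pos: "0 < B v v" using B_nonneg[OF v] by simp
    \<comment> \<open>The polynomial is evaluated at its minimum.\<close>
    have "0 \<le> B u u - (B u v)\<^sup>2 / B v v"
      using q[of "- B u v / B v v"] pos by (simp add: power2_eq_square field_simps)
    then show ?thesis using pos by (simp add: field_simps)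
  qed
  then have "sqrt ((B u v)\<^sup>2) \<le> sqrt (B u u * B v v)" by (rule real_sqrt_le_mono)
  then show ?thesis by (simp add: nrm_def real_sqrt_mult)
qed

lemma nrm_add:
  assumes u: "u \<in> V" and v: "v \<in> V"
  shows "nrm (\<lambda>x. u x + v x) \<le> nrm u + nrm v"
proof (rule power2_le_imp_le)
  have "(nrm (\<lambda>x. u x + v x))\<^sup>2 = B u u + 2 * B u v + B v v"
    using B_add_scale_square[OF u v, of 1] nrm_sq[OF add_mem[OF u v]] by simp
  also have "\<dots> \<le> (nrm u)\<^sup>2 + 2 * (nrm u * nrm v) + (nrm v)\<^sup>2"
    using cauchy_schwarz[OF u v] nrm_sq[OF u] nrm_sq[OF v] by linarith
  also have "\<dots> = (nrm u + nrm v)\<^sup>2" by (simp add: power2_eq_square algebra_simps)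
  finally show "(nrm (\<lambda>x. u x + v x))\<^sup>2 \<le> (nrm u + nrm v)\<^sup>2" .
qed (simp add: nrm_nonneg u v)

lemma nrm_le_nrm_diff:
  assumes u: "u \<in> V" and v: "v \<in> V"
  shows "nrm u \<le> nrm v + nrm (\<lambda>x. u x - v x)"
  using nrm_add[OF v diff_mem[OF u v]] by simp

lemma sum_mem: "(\<And>n::nat. f n \<in> V) \<Longrightarrow> (\<lambda>x. \<Sum>n\<in>I. f n x) \<in> V"
proof (induction I rule: infinite_finite_induct)
  case (insert i I)
  then show ?case using add_mem[of "f i" "\<lambda>x. \<Sum>n\<in>I. f n x"] by simp
qed (simp_all add: zero_mem)

lemma nrm_sum: "(\<And>n::nat. f n \<in> V) \<Longrightarrow> nrm (\<lambda>x. \<Sum>n\<in>I. f n x) \<le> (\<Sum>n\<in>I. nrm (f n))"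
proof (induction I rule: infinite_finite_induct)
  case (insert i I)
  then show ?case using nrm_add[of "f i" "\<lambda>x. \<Sum>n\<in>I. f n x"] sum_mem[of f I]
    by (fastforce intro: order_trans)
qed (simp_all add: nrm_def B_zero zero_mem)

lemma B_tendsto:
  assumes s: "\<And>n::nat. s n \<in> V" and p: "p \<in> V" and v: "v \<in> V"
    and lim: "(\<lambda>n. nrm (\<lambda>x. s n x - p x)) \<longlonglongrightarrow> 0"
  shows "(\<lambda>n. B (s n) v) \<longlonglongrightarrow> B p v"
proof (rule LIM_zero_cancel, rule Lim_null_comparison)
  show "\<forall>\<^sub>F n in sequentially. norm (B (s n) v - B p v) \<le> nrm (\<lambda>x. s n x - p x) * nrm v"
    using cauchy_schwarz[OF diff_mem[OF s p] v] B_diff[OF s p v] by simp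
  show "(\<lambda>n. nrm (\<lambda>x. s n x - p x) * nrm v) \<longlonglongrightarrow> 0"
    using tendsto_mult_right[OF lim, of "nrm v"] by simp
qed

lemma nrm_tendsto:
  assumes s: "\<And>n::nat. s n \<in> V" and p: "p \<in> V"
    and lim: "(\<lambda>n. nrm (\<lambda>x. s n x - p x)) \<longlonglongrightarrow> 0"
  shows "(\<lambda>n. nrm (s n)) \<longlonglongrightarrow> nrm p"
proof (rule LIM_zero_cancel, rule Lim_null_comparison[OF _ lim])
  have "\<bar>nrm (s n) - nrm p\<bar> \<le> nrm (\<lambda>x. s n x - p x)" for n
    using nrm_le_nrm_diff[OF s p, of n] nrm_le_nrm_diff[OF p s, of n] nrm_diff_commute[OF s p, of n]
    by linarith
  then show "\<forall>\<^sub>F n in sequentially. norm (nrm (s n) - nrm p) \<le> nrm (\<lambda>x. s n x - p x)"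
    by simp
qed

section \<open>Projection onto convex cones and Riesz representation\<close>

lemma cone_minimizer:
  assumes sub: "C \<subseteq> V" and ne: "(\<lambda>x. 0) \<in> C"
    and Cadd: "\<And>a b. a \<in> C \<Longrightarrow> b \<in> C \<Longrightarrow> (\<lambda>x. a x + b x) \<in> C"
    and Cscale: "\<And>t a. 0 < t \<Longrightarrow> a \<in> C \<Longrightarrow> (\<lambda>x. t * a x) \<in> C"
    and padd: "\<And>f g. f \<in> V \<Longrightarrow> g \<in> V \<Longrightarrow> \<phi> (\<lambda>x. f x + g x) = \<phi> f + \<phi> g"
    and pscale: "\<And>c f. f \<in> V \<Longrightarrow> \<phi> (\<lambda>x. c * f x) = c * \<phi> f"
    and pbound: "\<And>f. f \<in> V \<Longrightarrow> \<bar>\<phi> f\<bar> \<le> K * nrm f"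
  obtains p where "p \<in> V" "\<And>c. c \<in> C \<Longrightarrow> \<phi> c \<le> B p c" "B p p \<le> \<phi> p"
    "\<And>\<epsilon>. \<epsilon> > 0 \<Longrightarrow> \<exists>c\<in>C. nrm (\<lambda>x. p x - c x) < \<epsilon>"
proof -
  define J where "J f = B f f - 2 * \<phi> f" for f
  have Jadd: "J (\<lambda>x. f x + t * g x) = J f + 2 * t * (B f g - \<phi> g) + t\<^sup>2 * B g g"
    if "f \<in> V" "g \<in> V" for f g t
    using that by (simp add: J_def B_add_scale_square padd pscale scale_mem algebra_simps)
  \<comment> \<open>Completing the square bounds \<open>J\<close> from below, so that its infimum
    over \<open>C\<close> exists.\<close>
  have Jlow: "- (K\<^sup>2) \<le> J f" if f: "f \<in> V" for f
  proof -
    have "0 \<le> (nrm f - K)\<^sup>2" by simp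
    then have "- (K\<^sup>2) \<le> (nrm f)\<^sup>2 - 2 * (K * nrm f)" by (simp add: power2_eq_square algebra_simps)
    then show ?thesis using pbound[OF f] nrm_sq[OF f] by (simp add: J_def)
  qed
  define d where "d = Inf (J ` C)"
  have bdd: "bdd_below (J ` C)" using Jlow sub by (intro bdd_belowI[of _ "- (K\<^sup>2)"]) auto
  have dle: "d \<le> J c" if "c \<in> C" for c
    unfolding d_def using bdd that by (intro cInf_lower) auto
  have "\<exists>c\<in>C. J c < d + inverse (real (Suc n))" for n
  proof -
    have "Inf (J ` C) < d + inverse (real (Suc n))" unfolding d_def by simp
    then show ?thesis using cInf_lessD[of "J ` C"] ne by blast
  qed
  then obtain s where sC: "\<And>n. s n \<in> C" and sJ: "\<And>n. J (s n) < d + inverse (real (Suc n))"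
    by metis
  have sV: "s n \<in> V" for n using sC sub by blast
  \<comment> \<open>Parallelogram argument: the midpoint of two iterates lies in the cone, so
    \<open>J\<close> is at least \<open>d\<close> there. Expanding \<open>J\<close> around
    \<open>s n\<close> turns this into a bound on their distance.\<close>
  have par: "(nrm (\<lambda>x. s m x - s n x))\<^sup>2 \<le> 2 * (inverse (real (Suc m)) + inverse (real (Suc n)))" for m n
  proof -
    let ?a = "s m" and ?b = "s n"
    have mid: "(\<lambda>x. ?b x + (1/2) * (?a x - ?b x)) \<in> C"
      using Cscale[OF _ Cadd[OF sC[of m] sC[of n]], of "1/2"] by (simp add: field_simps)
    have D: "(\<lambda>x. ?a x - ?b x) \<in> V" using diff_mem sV by blast
    have 1: "J (\<lambda>x. ?b x + (1/2) * (?a x - ?b x)) =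
        J ?b + (B ?b (\<lambda>x. ?a x - ?b x) - \<phi> (\<lambda>x. ?a x - ?b x)) + (1/4) * B (\<lambda>x. ?a x - ?b x) (\<lambda>x. ?a x - ?b x)"
      using Jadd[OF sV[of n] D, of "1/2"] by (simp add: power2_eq_square)
    have 2: "J ?a =
        J ?b + 2 * (B ?b (\<lambda>x. ?a x - ?b x) - \<phi> (\<lambda>x. ?a x - ?b x)) + B (\<lambda>x. ?a x - ?b x) (\<lambda>x. ?a x - ?b x)"
      using Jadd[OF sV[of n] D, of "1"] by simp
    have "D' \<le> 2 * (i + k)"
      if "j = b + X + 1/4 * D" "a = b + 2 * X + D" "d \<le> j" "a < d + i" "b < d + k" "D' = D"
      for j a b X D D' i k :: real
      using that by argo
    from this[OF 1 2 dle[OF mid] sJ sJ nrm_sq[OF D]] show ?thesis .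
  qed
  have "\<exists>n0. \<forall>m\<ge>n0. \<forall>n\<ge>n0. sqrt (B (\<lambda>x. s m x - s n x) (\<lambda>x. s m x - s n x)) < \<epsilon>" if e: "0 < \<epsilon>" for \<epsilon>
  proof -
    have "0 < \<epsilon>\<^sup>2 / 4" using e by simp
    then obtain n0 where n0: "inverse (real (Suc n0)) < \<epsilon>\<^sup>2 / 4" using reals_Archimedean by blast
    have "nrm (\<lambda>x. s m x - s n x) < \<epsilon>" if "m \<ge> n0" "n \<ge> n0" for m n
    proof (rule power2_less_imp_less)
      have "inverse (real (Suc m)) \<le> inverse (real (Suc n0))" "inverse (real (Suc n)) \<le> inverse (real (Suc n0))"
        using that by (auto intro!: le_imp_inverse_le)
      then show "(nrm (\<lambda>x. s m x - s n x))\<^sup>2 < \<epsilon>\<^sup>2" using par[of m n] n0 by argo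
    qed (use e in simp)
    then show ?thesis unfolding nrm_def by blast
  qed
  from complete[OF sV this] obtain p where p: "p \<in> V" and lim: "(\<lambda>n. nrm (\<lambda>x. s n x - p x)) \<longlonglongrightarrow> 0"
    unfolding nrm_def by blast
  have inv0: "(\<lambda>n. inverse (real (Suc n))) \<longlonglongrightarrow> 0" by (rule LIMSEQ_inverse_real_of_nat)
  \<comment> \<open>First variation in the direction \<open>c\<close>. The limit in \<open>n\<close>
    comes first, with \<open>t\<close> fixed, so that the error
    \<open>inverse (real (Suc n))\<close> is gone before dividing by \<open>t\<close>.\<close>
  have var: "\<phi> c \<le> B p c" if c: "c \<in> C" for c
  proof -
    have cV: "c \<in> V" using c sub by blast
    have "0 \<le> 2 * (B p c - \<phi> c) + t * B c c" if t: "0 < t" for t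
    proof -
      have ge: "0 \<le> inverse (real (Suc n)) + (2 * t * (B (s n) c - \<phi> c) + t\<^sup>2 * B c c)" for n
        using dle[OF Cadd[OF sC[of n] Cscale[OF t c]]] Jadd[OF sV[of n] cV, of t] sJ[of n] by linarith
      have "(\<lambda>n. inverse (real (Suc n)) + (2 * t * (B (s n) c - \<phi> c) + t\<^sup>2 * B c c))
          \<longlonglongrightarrow> 0 + (2 * t * (B p c - \<phi> c) + t\<^sup>2 * B c c)"
        by (intro tendsto_intros inv0 B_tendsto[OF sV p cV lim])
      then have "0 \<le> 2 * t * (B p c - \<phi> c) + t\<^sup>2 * B c c" using ge
        by (intro LIMSEQ_le_const[where a=0]) auto
      then have "0 \<le> t * (2 * (B p c - \<phi> c) + t * B c c)" by (simp add: algebra_simps power2_eq_square)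
      then show ?thesis using t by (simp add: zero_le_mult_iff)
    qed
    then have "((\<lambda>t. 2 * (B p c - \<phi> c) + t * B c c) \<longlongrightarrow> 2 * (B p c - \<phi> c) + 0 * B c c) (at_right 0) \<Longrightarrow>
        0 \<le> 2 * (B p c - \<phi> c) + 0 * B c c"
      by (intro tendsto_lowerbound[where F="at_right 0"])
        (auto simp: eventually_at_right_less intro: eventually_mono[OF eventually_at_right_less])
    moreover have "((\<lambda>t. 2 * (B p c - \<phi> c) + t * B c c) \<longlongrightarrow> 2 * (B p c - \<phi> c) + 0 * B c c) (at_right 0)"
      by (intro tendsto_intros)
    ultimately show ?thesis by simp
  qed
  have plim: "(\<lambda>n. \<phi> (s n)) \<longlonglongrightarrow> \<phi> p"
  proof (rule LIM_zero_cancel, rule Lim_null_comparison)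
    have "\<phi> (\<lambda>x. s n x - p x) = \<phi> (s n) - \<phi> p" for n
      using padd[OF sV[of n] scale_mem[OF p, of "-1"]] pscale[OF p, of "-1"] by simp
    then show "\<forall>\<^sub>F n in sequentially. norm (\<phi> (s n) - \<phi> p) \<le> K * nrm (\<lambda>x. s n x - p x)"
      using pbound[OF diff_mem[OF sV p]] by simp
    show "(\<lambda>n. K * nrm (\<lambda>x. s n x - p x)) \<longlonglongrightarrow> 0"
      using tendsto_mult_left[OF lim, of K] by simp
  qed
  have Blim: "(\<lambda>n. B (s n) (s n)) \<longlonglongrightarrow> B p p"
    using tendsto_power[OF nrm_tendsto[OF sV p lim], of 2] nrm_sq sV p by simp
  \<comment> \<open>Iterates may also be shrunk within the cone, since \<open>1 - t\<close> is
    positive. This is the first variation along the ray through \<open>p\<close>, pointing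
    inwards.\<close>
  have "0 \<le> - 2 * (B p p - \<phi> p) + t * B p p" if t: "0 < t" "t < 1" for t
  proof -
    have ge: "0 \<le> inverse (real (Suc n)) + (2 * - t * (B (s n) (s n) - \<phi> (s n)) + t\<^sup>2 * B (s n) (s n))" for n
    proof -
      have "(\<lambda>x. s n x + (- t) * s n x) \<in> C"
        using Cscale[OF _ sC[of n], of "1 - t"] t by (simp add: algebra_simps)
      from dle[OF this] show ?thesis using Jadd[OF sV[of n] sV[of n], of "-t"] sJ[of n] by simp
    qed
    have "(\<lambda>n. inverse (real (Suc n)) + (2 * - t * (B (s n) (s n) - \<phi> (s n)) + t\<^sup>2 * B (s n) (s n)))
        \<longlonglongrightarrow> 0 + (2 * - t * (B p p - \<phi> p) + t\<^sup>2 * B p p)"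
      by (intro tendsto_intros inv0 Blim plim)
    then have "0 \<le> 2 * - t * (B p p - \<phi> p) + t\<^sup>2 * B p p" using ge
      by (intro LIMSEQ_le_const[where a=0]) auto
    then have "0 \<le> t * (- 2 * (B p p - \<phi> p) + t * B p p)" by (simp add: algebra_simps power2_eq_square)
    then show ?thesis using t by (simp add: zero_le_mult_iff)
  qed
  then have "((\<lambda>t. - 2 * (B p p - \<phi> p) + t * B p p) \<longlongrightarrow> - 2 * (B p p - \<phi> p) + 0 * B p p) (at_right 0) \<Longrightarrow>
      0 \<le> - 2 * (B p p - \<phi> p) + 0 * B p p"
    by (intro tendsto_lowerbound[where F="at_right 0"])
      (auto intro!: eventually_at_rightI[of 0 1])
  moreover have "((\<lambda>t. - 2 * (B p p - \<phi> p) + t * B p p) \<longlongrightarrow> - 2 * (B p p - \<phi> p) + 0 * B p p) (at_right 0)"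
    by (intro tendsto_intros)
  ultimately have pp: "B p p \<le> \<phi> p" by simp
  have app: "\<exists>c\<in>C. nrm (\<lambda>x. p x - c x) < \<epsilon>" if "\<epsilon> > 0" for \<epsilon>
  proof -
    obtain n where "nrm (\<lambda>x. s n x - p x) < \<epsilon>"
      using order_tendstoD(2)[OF lim \<open>\<epsilon> > 0\<close>] by (auto simp: eventually_sequentially)
    then show ?thesis using sC nrm_diff_commute[OF sV p] by metis
  qed
  show ?thesis using that[OF p var pp app] by blast
qed

text \<open>Take the whole space as the cone; the variational inequality for \<open>f\<close> and
  for \<open>- f\<close> becomes an equality.\<close>

lemma riesz_representation:
  assumes "\<And>f g. f \<in> V \<Longrightarrow> g \<in> V \<Longrightarrow> \<phi> (\<lambda>x. f x + g x) = \<phi> f + \<phi> g"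
    and sc: "\<And>c f. f \<in> V \<Longrightarrow> \<phi> (\<lambda>x. c * f x) = c * \<phi> f"
    and "\<And>f. f \<in> V \<Longrightarrow> \<bar>\<phi> f\<bar> \<le> K * nrm f"
  obtains p where "p \<in> V" "\<And>f. f \<in> V \<Longrightarrow> B p f = \<phi> f"
proof -
  obtain p where p: "p \<in> V" and le: "\<And>c. c \<in> V \<Longrightarrow> \<phi> c \<le> B p c"
    by (rule cone_minimizer[OF subset_refl zero_mem add_mem scale_mem assms]) blast+
  have "B p f = \<phi> f" if f: "f \<in> V" for f
    using le[OF f] le[OF minus_mem[OF f]] sc[OF f, of "-1"] B_minus_right[OF f p] by simp
  with p show ?thesis using that by blast
qed

text \<open>The separating vector is the residual \<open>u - p\<close>, where \<open>p\<close> is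
  the projection of \<open>u\<close> onto the closure of \<open>C\<close>.\<close>

lemma cone_separation:
  assumes "C \<subseteq> V" "(\<lambda>x. 0) \<in> C"
    and "\<And>a b. a \<in> C \<Longrightarrow> b \<in> C \<Longrightarrow> (\<lambda>x. a x + b x) \<in> C"
    and "\<And>t a. 0 < t \<Longrightarrow> a \<in> C \<Longrightarrow> (\<lambda>x. t * a x) \<in> C"
    and u: "u \<in> V"
    and far: "\<epsilon> > 0" "\<And>c. c \<in> C \<Longrightarrow> \<epsilon> \<le> nrm (\<lambda>x. u x - c x)"
  obtains n where "n \<in> V" "\<And>c. c \<in> C \<Longrightarrow> B n c \<le> 0" "0 < B n u"
proof -
  have cs: "\<bar>B u f\<bar> \<le> nrm u * nrm f" if "f \<in> V" for f using cauchy_schwarz[OF u that] .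
  obtain p where p: "p \<in> V" and le: "\<And>c. c \<in> C \<Longrightarrow> B u c \<le> B p c" and pp: "B p p \<le> B u p"
    and app: "\<And>\<epsilon>. \<epsilon> > 0 \<Longrightarrow> \<exists>c\<in>C. nrm (\<lambda>x. p x - c x) < \<epsilon>"
    by (rule cone_minimizer[OF assms(1-4) B_add_right[OF _ _ u] B_scale_right[OF _ u] cs]) blast+
  let ?n = "\<lambda>x. u x - p x"
  have n: "?n \<in> V" using diff_mem u p by blast
  \<comment> \<open>With zero residual, points of \<open>C\<close> close to \<open>p\<close> would
    be closer to \<open>u\<close> than \<epsilon>.\<close>
  have "nrm ?n \<noteq> 0"
  proof
    assume 0: "nrm ?n = 0"
    obtain c where c: "c \<in> C" "nrm (\<lambda>x. p x - c x) < \<epsilon>" using app far(1) by blast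
    then have "c \<in> V" using assms(1) by blast
    then show False
      using far(2)[OF c(1)] c(2) 0 nrm_add[OF n diff_mem[OF p \<open>c \<in> V\<close>]] by simp
  qed
  then have "0 < B ?n ?n" using nrm_sq[OF n] by (metis zero_less_power2)
  \<comment> \<open>The right side exceeds the left by \<open>B u p - B p p\<close>, which is
    nonnegative by \<open>pp\<close>.\<close>
  moreover have "B ?n ?n \<le> B ?n u"
    using pp by (simp add: B_diff_right B_diff u p n B_sym[of p u])
  ultimately have "0 < B ?n u" by simp
  moreover have "B ?n c \<le> 0" if "c \<in> C" for c
    using le[OF that] B_diff[OF u p, of c] that assms(1) by auto
  ultimately show ?thesis using that n by blast
qed


section \<open>Dual norm and the Riesz map\<close>

text \<open>A supremum of reals is informative only for bounded sets, so boundedness on the unit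
  ball comes first. Vectors of nonzero seminorm are rescaled to the unit sphere; on the others the
  continuity bound forces \<open>\<phi> f = 0\<close>.\<close>

lemma dual_norm_bound:
  assumes \<phi>: "\<phi> \<in> dual_space V nrm" and f: "f \<in> V"
  shows "\<bar>\<phi> f\<bar> \<le> dual_norm V nrm \<phi> * nrm f"
proof -
  obtain C where C: "\<And>f. f \<in> V \<Longrightarrow> \<bar>\<phi> f\<bar> \<le> C * nrm f"
    using \<phi> unfolding dual_space_def by blast
  have "\<bar>\<phi> g\<bar> \<le> \<bar>C\<bar>" if "g \<in> V" "nrm g \<le> 1" for g
  proof -
    have "\<bar>\<phi> g\<bar> \<le> C * nrm g" using C that by blast
    also have "\<dots> \<le> \<bar>C\<bar> * 1" using that nrm_nonneg by (intro mult_mono) auto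
    finally show ?thesis by simp
  qed
  then have bdd: "bdd_above ((\<lambda>f. \<bar>\<phi> f\<bar>) ` {f \<in> V. nrm f \<le> 1})" by (auto intro!: bdd_aboveI)
  show ?thesis
  proof (cases "nrm f = 0")
    case True
    then show ?thesis using C[OF f] by simp
  next
    case False
    then have pos: "0 < nrm f" using nrm_nonneg[OF f] by simp
    let ?g = "\<lambda>x. inverse (nrm f) * f x"
    have "?g \<in> V" "nrm ?g \<le> 1" using f pos by (auto simp: scale_mem nrm_scale)
    then have "\<bar>\<phi> ?g\<bar> \<le> dual_norm V nrm \<phi>"
      unfolding dual_norm_def using bdd by (intro cSUP_upper) auto
    moreover have "\<phi> ?g = inverse (nrm f) * \<phi> f" using \<phi> f unfolding dual_space_def by blast
    ultimately have "\<bar>inverse (nrm f) * \<phi> f\<bar> \<le> dual_norm V nrm \<phi>" by (simp only:)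
    then show ?thesis using pos by (simp add: abs_mult field_simps)
  qed
qed

text \<open>The value zero off \<open>V\<close> matches the convention of \<open>dual_space\<close>,
  so that equality of functionals is equality of functions.\<close>

definition riesz :: "('b \<Rightarrow> real) \<Rightarrow> ('b \<Rightarrow> real) \<Rightarrow> real"
  where "riesz n = (\<lambda>f. if f \<in> V then B n f else 0)"

lemma riesz_mem_dual: "n \<in> V \<Longrightarrow> riesz n \<in> dual_space V nrm"
  unfolding dual_space_def riesz_def
  by (auto simp: B_add_right B_scale_right add_mem scale_mem intro: cauchy_schwarz)

lemma dual_norm_riesz_le: "n \<in> V \<Longrightarrow> dual_norm V nrm (riesz n) \<le> nrm n"
  unfolding dual_norm_def
proof (rule cSUP_least)
  show "{f \<in> V. nrm f \<le> 1} \<noteq> {}" using zero_mem B_zero[OF zero_mem] by (auto simp: nrm_def)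
  fix f assume "n \<in> V" "f \<in> {f \<in> V. nrm f \<le> 1}"
  then have f: "f \<in> V" "nrm f \<le> 1" and n: "n \<in> V" by auto
  have "\<bar>B n f\<bar> \<le> nrm n * nrm f" by (rule cauchy_schwarz[OF n f(1)])
  also have "\<dots> \<le> nrm n" using f nrm_nonneg[OF n] by (simp add: mult_left_le)
  finally show "\<bar>riesz n f\<bar> \<le> nrm n" using f by (simp add: riesz_def)
qed

text \<open>This allows statements about the dual to be moved to \<open>V\<close>, where projection
  and separation are available.\<close>

lemma riesz_surj:
  assumes \<phi>: "\<phi> \<in> dual_space V nrm"
  obtains p where "p \<in> V" "riesz p = \<phi>"
proof -
  obtain K where "\<And>f. f \<in> V \<Longrightarrow> \<bar>\<phi> f\<bar> \<le> K * nrm f"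
    using \<phi> unfolding dual_space_def by blast
  moreover have "\<phi> (\<lambda>x. f x + g x) = \<phi> f + \<phi> g" if "f \<in> V" "g \<in> V" for f g
    using \<phi> that unfolding dual_space_def by blast
  moreover have "\<phi> (\<lambda>x. c * f x) = c * \<phi> f" if "f \<in> V" for c f
    using \<phi> that unfolding dual_space_def by blast
  ultimately obtain p where p: "p \<in> V" "\<And>f. f \<in> V \<Longrightarrow> B p f = \<phi> f"
    using riesz_representation[of \<phi> K] by blast
  moreover have "\<phi> f = 0" if "f \<notin> V" for f using \<phi> that unfolding dual_space_def by blast
  ultimately have "riesz p = \<phi>" by (auto simp: riesz_def)
  with p show ?thesis using that by blast
qed

lemma riesz_diff: "n \<in> V \<Longrightarrow> p \<in> V \<Longrightarrow> (\<lambda>f. riesz n f - riesz p f) = riesz (\<lambda>x. n x - p x)"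
  by (auto simp: riesz_def B_diff)

end

section \<open>Truncation and capacity\<close>

lemma L2_mult_integrable:
  assumes "u \<in> L2 \<mu>" "v \<in> L2 \<mu>"
  shows "integrable \<mu> (\<lambda>x. u x * v x)"
proof (rule Bochner_Integration.integrable_bound)
  show "integrable \<mu> (\<lambda>x. (u x)\<^sup>2 + (v x)\<^sup>2)" using assms by (simp add: L2_def)
  show "(\<lambda>x. u x * v x) \<in> borel_measurable \<mu>" using assms by (auto simp: L2_def)
  have "\<bar>u x * v x\<bar> \<le> (u x)\<^sup>2 + (v x)\<^sup>2" for x
  proof -
    have "2 * \<bar>u x * v x\<bar> \<le> (u x)\<^sup>2 + (v x)\<^sup>2"
      using sum_squares_bound[of "\<bar>u x\<bar>" "\<bar>v x\<bar>"] by (simp add: abs_mult mult.assoc)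
    then show ?thesis using abs_ge_zero[of "u x * v x"] by linarith
  qed
  then show "AE x in \<mu>. norm (u x * v x) \<le> norm ((u x)\<^sup>2 + (v x)\<^sup>2)" by simp
qed

sublocale dirichlet_space \<subseteq> H: semi_hilbert_space V "E1 \<mu> E"
  rewrites "semi_hilbert_space.nrm (E1 \<mu> E) = E1_norm \<mu> E"
proof -
  have int: "integrable \<mu> (\<lambda>x. u x * v x)" if "u \<in> V" "v \<in> V" for u v
    using that V_L2 by (intro L2_mult_integrable) auto
  show *: "semi_hilbert_space V (E1 \<mu> E)"
  proof
    fix s :: "nat \<Rightarrow> 'a \<Rightarrow> real"
    assume "\<And>n. s n \<in> V" "\<And>\<epsilon>. \<epsilon> > 0 \<Longrightarrow> \<exists>n0. \<forall>m\<ge>n0. \<forall>n\<ge>n0.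
        sqrt (E1 \<mu> E (\<lambda>x. s m x - s n x) (\<lambda>x. s m x - s n x)) < \<epsilon>"
    then show "\<exists>u\<in>V. (\<lambda>n. sqrt (E1 \<mu> E (\<lambda>x. s n x - u x) (\<lambda>x. s n x - u x))) \<longlonglongrightarrow> 0"
      using V_complete[of s] unfolding E1_norm_def by blast
  next
    fix u v w assume "u \<in> V" "v \<in> V" "w \<in> V"
    then show "E1 \<mu> E (\<lambda>x. u x + v x) w = E1 \<mu> E u w + E1 \<mu> E v w"
      by (simp add: E1_def L2_inner_def E_add distrib_right int)
  next
    fix u v assume "u \<in> V" "v \<in> V"
    then show "E1 \<mu> E u v = E1 \<mu> E v u"
      using E_sym[of u v] by (simp add: E1_def L2_inner_def mult.commute)
  qed (auto simp: E1_def L2_inner_def V_zero V_add V_scale E_scale E_nonneg mult.assoc distrib_left)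
  show "semi_hilbert_space.nrm (E1 \<mu> E) = E1_norm \<mu> E"
    by (auto simp: semi_hilbert_space.nrm_def[OF *] E1_norm_def)
qed

definition unit_truncation :: "('a \<Rightarrow> real) \<Rightarrow> 'a \<Rightarrow> real"
  where "unit_truncation u = (\<lambda>x. min 1 (max 0 (u x)))"

context dirichlet_space
begin

lemma V_measurable: "u \<in> V \<Longrightarrow> u \<in> borel_measurable \<mu>"
  using V_L2 by (auto simp: L2_def)

lemma L2_inner_self_le_E1: "u \<in> V \<Longrightarrow> L2_inner \<mu> u u \<le> E1 \<mu> E u u"
  by (simp add: E1_def E_nonneg)

lemma unit_truncation_mem: "u \<in> V \<Longrightarrow> unit_truncation u \<in> V"
  using E_contraction by (simp add: unit_truncation_def)

text \<open>Both summands of \<open>E1\<close> decrease: the form by the contraction property, the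
  \<open>L2\<close> part pointwise.\<close>

lemma E1_norm_unit_truncation_le:
  assumes u: "u \<in> V"
  shows "E1_norm \<mu> E (unit_truncation u) \<le> E1_norm \<mu> E u"
proof -
  have "\<bar>min 1 (max 0 (u x))\<bar> \<le> \<bar>u x\<bar>" for x by auto
  then have "(unit_truncation u x)\<^sup>2 \<le> (u x)\<^sup>2" for x
    unfolding unit_truncation_def by (metis abs_le_square_iff)
  then have "L2_inner \<mu> (unit_truncation u) (unit_truncation u) \<le> L2_inner \<mu> u u"
    unfolding L2_inner_def
    using V_L2 u unit_truncation_mem[OF u]
    by (intro integral_mono L2_mult_integrable) (auto simp: power2_eq_square)
  then show ?thesis
    using E_contraction[OF u] by (simp add: E1_norm_def E1_def unit_truncation_def)
qed

text \<open>The norm of \<open>E1\<close> dominates that of \<open>L2\<close>. The squared positive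
  part \<open>g\<close> of \<open>w - p\<close> lies below \<open>(v n - p)\<^sup>2\<close> almost
  everywhere for \<open>n \<ge> N\<close>, so its integral is zero.\<close>

lemma AE_le_of_E1_norm_tendsto:
  assumes v: "\<And>n::nat. v n \<in> V" and p: "p \<in> V" and w: "w \<in> borel_measurable \<mu>"
    and lim: "(\<lambda>n. E1_norm \<mu> E (\<lambda>x. v n x - p x)) \<longlonglongrightarrow> 0"
    and ev: "\<And>n. N \<le> n \<Longrightarrow> AE x in \<mu>. w x \<le> v n x"
  shows "AE x in \<mu>. w x \<le> p x"
proof -
  define g where "g x = (max 0 (w x - p x))\<^sup>2" for x
  have gm: "g \<in> borel_measurable \<mu>" unfolding g_def using w V_measurable[OF p] by measurable
  have gle: "AE x in \<mu>. g x \<le> (v n x - p x)\<^sup>2" if "N \<le> n" for n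
    using ev[OF that]
  proof eventually_elim
    case (elim x)
    have "max 0 (w x - p x) \<le> \<bar>v n x - p x\<bar>" using elim by auto
    then show ?case unfolding g_def by (metis abs_le_square_iff abs_of_nonneg max.cobounded1)
  qed
  have di: "integrable \<mu> (\<lambda>x. (v n x - p x)\<^sup>2)" for n
    using H.diff_mem[OF v p] V_L2 by (auto simp: L2_def)
  have gi: "integrable \<mu> g"
    by (rule Bochner_Integration.integrable_bound[OF di gm])
      (use gle[of N] in \<open>auto simp: g_def\<close>)
  have "integral\<^sup>L \<mu> g \<le> (E1_norm \<mu> E (\<lambda>x. v n x - p x))\<^sup>2" if "N \<le> n" for n
  proof -
    have "integral\<^sup>L \<mu> g \<le> (\<integral>x. (v n x - p x)\<^sup>2 \<partial>\<mu>)"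
      by (rule integral_mono_AE[OF gi di gle[OF that]])
    also have "\<dots> \<le> (E1_norm \<mu> E (\<lambda>x. v n x - p x))\<^sup>2"
      using L2_inner_self_le_E1[OF H.diff_mem[OF v p]] H.nrm_sq[OF H.diff_mem[OF v p]]
      by (simp add: L2_inner_def power2_eq_square)
    finally show ?thesis .
  qed
  then have "integral\<^sup>L \<mu> g \<le> 0\<^sup>2"
    by (intro LIMSEQ_le_const[OF tendsto_power[OF lim]]) blast
  moreover have "0 \<le> integral\<^sup>L \<mu> g" by (simp add: g_def)
  ultimately have "integral\<^sup>L \<mu> g = 0" by simp
  then have "AE x in \<mu>. g x = 0"
    using integral_nonneg_eq_0_iff_AE[OF gi] by (simp add: g_def)
  then show ?thesis by eventually_elim (auto simp: g_def max_def split: if_splits)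
qed

end

lemma capacity_leI:
  assumes "v \<in> V" "open G" "A \<subseteq> G" "AE x in \<mu>. x \<in> G \<longrightarrow> 1 \<le> v x"
  shows "capacity \<mu> V E A \<le> ennreal (E1 \<mu> E v v)"
  unfolding capacity_def by (rule Inf_lower) (use assms in blast)

lemma capacity_lessE:
  assumes "capacity \<mu> V E A < ennreal \<epsilon>"
  obtains v G where "v \<in> V" "open G" "A \<subseteq> G" "AE x in \<mu>. x \<in> G \<longrightarrow> 1 \<le> v x" "E1 \<mu> E v v < \<epsilon>"
proof -
  obtain v G where "v \<in> V" "open G" "A \<subseteq> G" "AE x in \<mu>. x \<in> G \<longrightarrow> 1 \<le> v x"
    "ennreal (E1 \<mu> E v v) < ennreal \<epsilon>"
    using assms unfolding capacity_def Inf_less_iff by blast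
  then show ?thesis using that ennreal_leI not_less by metis
qed

lemma capacity_mono: "A \<subseteq> B \<Longrightarrow> capacity \<mu> V E A \<le> capacity \<mu> V E B"
  unfolding capacity_def by (rule Inf_superset_mono) blast

section \<open>Countable unions of sets of capacity zero\<close>

text \<open>Nonnegative test functions for the single sets, with norms summing to at most
  \<open>sqrt \<epsilon>\<close>, are added up. Completeness gives a limit that dominates each of
  them almost everywhere, hence is a test function for the union.\<close>

lemma (in regular_dirichlet_space) capacity_null_UN:
  fixes A :: "nat \<Rightarrow> 'a set"
  assumes null: "\<And>n. capacity \<mu> V E (A n) = 0"
  shows "capacity \<mu> V E (\<Union>n. A n) = 0"
proof -
  have "capacity \<mu> V E (\<Union>n. A n) \<le> 0 + ennreal \<epsilon>" if \<epsilon>: "0 < \<epsilon>" for \<epsilon> :: real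
  proof -
    \<comment> \<open>These numbers add up to \<open>sqrt \<epsilon>\<close>, which makes the energy
      of the limit at most \<epsilon>.\<close>
    define d where "d n = sqrt \<epsilon> * (1/2) ^ Suc n" for n
    have d: "0 < d n" for n using \<epsilon> by (simp add: d_def)
    have "\<exists>v G. v \<in> V \<and> open G \<and> A n \<subseteq> G \<and> (AE x in \<mu>. x \<in> G \<longrightarrow> 1 \<le> v x) \<and> E1 \<mu> E v v < (d n)\<^sup>2" for n
    proof -
      have "capacity \<mu> V E (A n) < ennreal ((d n)\<^sup>2)" using null d[of n] by simp
      then show ?thesis by (elim capacity_lessE) blast
    qed
    then have "\<forall>n. \<exists>v G. v \<in> V \<and> open G \<and> A n \<subseteq> G \<and> (AE x in \<mu>. x \<in> G \<longrightarrow> 1 \<le> v x) \<and> E1 \<mu> E v v < (d n)\<^sup>2"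
      by blast
    from choice[OF this] obtain w where "\<forall>n. \<exists>G. w n \<in> V \<and> open G \<and> A n \<subseteq> G \<and>
        (AE x in \<mu>. x \<in> G \<longrightarrow> 1 \<le> w n x) \<and> E1 \<mu> E (w n) (w n) < (d n)\<^sup>2" ..
    from choice[OF this] obtain G where "\<forall>n. w n \<in> V \<and> open (G n) \<and> A n \<subseteq> G n \<and>
        (AE x in \<mu>. x \<in> G n \<longrightarrow> 1 \<le> w n x) \<and> E1 \<mu> E (w n) (w n) < (d n)\<^sup>2" ..
    then have w: "\<And>n. w n \<in> V" and G: "\<And>n. open (G n)" "\<And>n. A n \<subseteq> G n"
      and w1: "\<And>n. AE x in \<mu>. x \<in> G n \<longrightarrow> 1 \<le> w n x" and wd: "\<And>n. E1 \<mu> E (w n) (w n) < (d n)\<^sup>2"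
      by simp_all
    \<comment> \<open>Truncation makes the summands nonnegative, so each of them lies below all
      later partial sums, and it does not increase the norm.\<close>
    define v where "v n = unit_truncation (w n)" for n
    have v: "v n \<in> V" for n using unit_truncation_mem w by (simp add: v_def)
    have v0: "0 \<le> v n x" for n x by (simp add: v_def unit_truncation_def)
    have v1: "AE x in \<mu>. x \<in> G n \<longrightarrow> 1 \<le> v n x" for n
      using w1[of n] by eventually_elim (auto simp: v_def unit_truncation_def)
    have vd: "E1_norm \<mu> E (v n) \<le> d n" for n
    proof -
      have "E1_norm \<mu> E (w n) \<le> d n"
        using wd[of n] d[of n] unfolding E1_norm_def by (intro real_le_lsqrt) auto
      then show ?thesis
        using E1_norm_unit_truncation_le[OF w[of n]] by (simp add: v_def)
    qed
    define s where "s m x = (\<Sum>n<m. v n x)" for m x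
    have s: "s m \<in> V" for m using H.sum_mem[of v "{..<m}"] v by (simp add: s_def[abs_def])
    have "d sums sqrt \<epsilon>"
      unfolding d_def using sums_mult[OF power_half_series, of "sqrt \<epsilon>"] by simp
    then have dsum: "summable d" and dlim: "suminf d = sqrt \<epsilon>" by (simp_all add: sums_iff)
    have dtot: "(\<Sum>n<m. d n) \<le> sqrt \<epsilon>" for m
      using sum_le_suminf[OF dsum, of "{..<m}"] d dlim by (simp add: less_imp_le)
    \<comment> \<open>The absolute value covers both orders of the indices. The case
      \<open>n = 0\<close> is reused below to bound the norm of \<open>s m\<close>.\<close>
    have tail: "E1_norm \<mu> E (\<lambda>x. s m x - s n x) \<le> \<bar>(\<Sum>n<m. d n) - (\<Sum>i<n. d i)\<bar>" for m n
    proof -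
      have *: "E1_norm \<mu> E (\<lambda>x. s m x - s n x) \<le> (\<Sum>n<m. d n) - (\<Sum>i<n. d i)" if "n \<le> m" for m n
      proof -
        have "(\<lambda>x. s m x - s n x) = (\<lambda>x. \<Sum>i\<in>{n..<m}. v i x)"
          using that by (simp add: s_def lessThan_atLeast0 sum_diff_nat_ivl)
        then have "E1_norm \<mu> E (\<lambda>x. s m x - s n x) \<le> (\<Sum>i\<in>{n..<m}. E1_norm \<mu> E (v i))"
          using H.nrm_sum[of v] v by simp
        also have "\<dots> \<le> (\<Sum>i\<in>{n..<m}. d i)" by (intro sum_mono vd)
        also have "\<dots> = (\<Sum>n<m. d n) - (\<Sum>i<n. d i)"
          using that by (simp add: lessThan_atLeast0 sum_diff_nat_ivl)
        finally show ?thesis .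
      qed
      show ?thesis
        using *[of n m] *[of m n] H.nrm_diff_commute[OF s s, of m n] by (cases "n \<le> m") auto
    qed
    have "\<exists>n0. \<forall>m\<ge>n0. \<forall>n\<ge>n0. E1_norm \<mu> E (\<lambda>x. s m x - s n x) < e" if "0 < e" for e
    proof -
      have "Cauchy (\<lambda>m. \<Sum>n<m. d n)" using dsum by (simp add: summable_iff_convergent convergent_Cauchy)
      then obtain n0 where "\<forall>m\<ge>n0. \<forall>n\<ge>n0. \<bar>(\<Sum>n<m. d n) - (\<Sum>i<n. d i)\<bar> < e"
        using \<open>0 < e\<close> unfolding Cauchy_def dist_real_def by blast
      then show ?thesis using tail by (meson le_less_trans)
    qed
    from V_complete[OF s this] obtain p where p: "p \<in> V"
      and lim: "(\<lambda>n. E1_norm \<mu> E (\<lambda>x. s n x - p x)) \<longlonglongrightarrow> 0" by blast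
    have "v n x \<le> s m x" if "Suc n \<le> m" for n m x
      unfolding s_def using that v0 by (intro member_le_sum) auto
    \<comment> \<open>The partial sum \<open>s m\<close> contains the term \<open>v n\<close> from
      \<open>m = Suc n\<close> on.\<close>
    then have "AE x in \<mu>. v n x \<le> p x" for n
      by (intro AE_le_of_E1_norm_tendsto[OF s p V_measurable[OF v] lim, of "Suc n"]) simp
    then have "AE x in \<mu>. \<forall>n. v n x \<le> p x" by (simp add: AE_all_countable)
    moreover have "AE x in \<mu>. \<forall>n. x \<in> G n \<longrightarrow> 1 \<le> v n x" using v1 by (simp add: AE_all_countable)
    ultimately have p1: "AE x in \<mu>. x \<in> (\<Union>n. G n) \<longrightarrow> 1 \<le> p x"
    proof eventually_elim
      case (elim x)
      then show ?case by (meson UN_E order_trans)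
    qed
    have "capacity \<mu> V E (\<Union>n. A n) \<le> ennreal (E1 \<mu> E p p)"
    proof (rule capacity_leI[OF p _ _ p1])
      show "open (\<Union>n. G n)" using G(1) by blast
      show "(\<Union>n. A n) \<subseteq> (\<Union>n. G n)" using G(2) by blast
    qed
    moreover have "E1_norm \<mu> E p \<le> sqrt \<epsilon>"
    proof (rule LIMSEQ_le_const2[OF H.nrm_tendsto[OF s p lim]])
      have "E1_norm \<mu> E (s m) \<le> sqrt \<epsilon>" for m
        using tail[of m 0] dtot[of m] sum_nonneg[of "{..<m}" d] d
        by (simp add: s_def[abs_def] less_imp_le)
      then show "\<exists>N. \<forall>n\<ge>N. E1_norm \<mu> E (s n) \<le> sqrt \<epsilon>" by blast
    qed
    then have "E1 \<mu> E p p \<le> \<epsilon>" by (simp add: E1_norm_def)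
    then have "ennreal (E1 \<mu> E p p) \<le> 0 + ennreal \<epsilon>" by (simp add: ennreal_leI)
    ultimately show ?thesis by (rule order_trans)
  qed
  then have "capacity \<mu> V E (\<Union>n. A n) \<le> 0" by (rule ennreal_le_epsilon)
  then show ?thesis by simp
qed

section \<open>The normal and tangent cones of the unit ball\<close>

lemma M_set_mult_integrable:
  assumes "v \<in> M_set \<mu>" "integrable \<mu> z"
  shows "integrable \<mu> (\<lambda>x. v x * z x)"
proof (rule Bochner_Integration.integrable_bound[OF assms(2)])
  show "(\<lambda>x. v x * z x) \<in> borel_measurable \<mu>"
    using assms by (auto simp: M_set_def Linf_def)
  have "AE x in \<mu>. -1 \<le> v x \<and> v x \<le> 1" using assms by (simp add: M_set_def)
  then show "AE x in \<mu>. norm (v x * z x) \<le> norm (z x)"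
    by eventually_elim (auto simp: abs_mult intro!: mult_left_le_one_le)
qed

lemma M_set_convex:
  assumes "v \<in> M_set \<mu>" "w \<in> M_set \<mu>" "0 \<le> s" "0 \<le> t" "s + t = 1"
  shows "(\<lambda>x. s * v x + t * w x) \<in> M_set \<mu>"
proof -
  have meas: "(\<lambda>x. s * v x + t * w x) \<in> borel_measurable \<mu>"
    using assms by (auto simp: M_set_def Linf_def)
  have "AE x in \<mu>. -1 \<le> v x \<and> v x \<le> 1" "AE x in \<mu>. -1 \<le> w x \<and> w x \<le> 1"
    using assms by (auto simp: M_set_def)
  then have *: "AE x in \<mu>. -1 \<le> s * v x + t * w x \<and> s * v x + t * w x \<le> 1"
  proof eventually_elim
    case (elim x)
    show ?case
      using convex_bound_le[of "v x" 1 "w x" s t] convex_bound_le[of "- v x" 1 "- w x" s t] elim assms(3-5)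
      by auto
  qed
  moreover from * have "AE x in \<mu>. \<bar>s * v x + t * w x\<bar> \<le> 1" by eventually_elim auto
  ultimately show ?thesis using meas by (auto simp: M_set_def Linf_def)
qed

lemma sgn_mem_M_set:
  assumes "z \<in> borel_measurable \<mu>"
  shows "(\<lambda>x. sgn (z x)) \<in> M_set \<mu>"
proof -
  have "(\<lambda>x. sgn (z x)) \<in> borel_measurable \<mu>" using assms by measurable
  moreover have "\<bar>sgn (z x)\<bar> \<le> 1" "-1 \<le> sgn (z x)" "sgn (z x) \<le> 1" for x by (auto simp: sgn_if)
  ultimately show ?thesis unfolding M_set_def Linf_def by blast
qed

text \<open>Maximality of \<open>q\<close> is tested with the competitor \<open>sgn z\<close>.\<close>

lemma maximizer_AE:
  assumes q: "q \<in> M_set \<mu>" and z: "integrable \<mu> z"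
    and max: "\<And>v. v \<in> M_set \<mu> \<Longrightarrow> (\<integral>x. v x * z x \<partial>\<mu>) \<le> (\<integral>x. q x * z x \<partial>\<mu>)"
  shows "AE x in \<mu>. q x * z x = \<bar>z x\<bar>"
proof -
  note qi = M_set_mult_integrable[OF q z]
  have sm: "(\<lambda>x. sgn (z x)) \<in> M_set \<mu>" using z by (intro sgn_mem_M_set) auto
  have eq: "(\<integral>x. sgn (z x) * z x \<partial>\<mu>) = (\<integral>x. \<bar>z x\<bar> \<partial>\<mu>)"
    by (intro Bochner_Integration.integral_cong) (auto simp: abs_sgn mult.commute)
  have i: "integrable \<mu> (\<lambda>x. \<bar>z x\<bar> - q x * z x)" using z qi by simp
  have "AE x in \<mu>. -1 \<le> q x \<and> q x \<le> 1" using q by (simp add: M_set_def)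
  then have nn: "AE x in \<mu>. 0 \<le> \<bar>z x\<bar> - q x * z x"
  proof eventually_elim
    case (elim x)
    have "\<bar>q x * z x\<bar> \<le> \<bar>z x\<bar>" using elim by (auto simp: abs_mult intro!: mult_left_le_one_le)
    then show ?case by linarith
  qed
  have "(\<integral>x. \<bar>z x\<bar> - q x * z x \<partial>\<mu>) \<le> 0"
    using max[OF sm] eq z qi by simp
  then have "(\<integral>x. \<bar>z x\<bar> - q x * z x \<partial>\<mu>) = 0"
    using integral_nonneg_AE[OF nn] by simp
  then have "AE x in \<mu>. \<bar>z x\<bar> - q x * z x = 0"
    using integral_nonneg_eq_0_iff_AE[OF i nn] by simp
  then show ?thesis by eventually_elim simp
qed

context dirichlet_space
begin

lemma V_integrable: "embeds_continuously_densely_L1 \<mu> V E \<Longrightarrow> u \<in> V \<Longrightarrow> integrable \<mu> u"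
  by (auto simp: embeds_continuously_densely_L1_def L1_def)

text \<open>The pairing with \<open>v\<close> is bounded by the \<open>L1\<close> norm, which the
  embedding bounds by the norm of \<open>V\<close>.\<close>

lemma functional_of_mem_dual:
  assumes emb: "embeds_continuously_densely_L1 \<mu> V E" and v: "v \<in> M_set \<mu>"
  shows "functional_of \<mu> V v \<in> V_dual \<mu> V E"
proof -
  note int = V_integrable[OF emb]
  note vi = M_set_mult_integrable[OF v int]
  obtain C where C: "\<And>u. u \<in> V \<Longrightarrow> L1_norm \<mu> u \<le> C * E1_norm \<mu> E u"
    using emb unfolding embeds_continuously_densely_L1_def by blast
  have "\<bar>\<integral>x. v x * u x \<partial>\<mu>\<bar> \<le> C * E1_norm \<mu> E u" if u: "u \<in> V" for u
  proof -
    have "AE x in \<mu>. -1 \<le> v x \<and> v x \<le> 1" using v by (simp add: M_set_def)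
    then have le: "AE x in \<mu>. \<bar>v x * u x\<bar> \<le> \<bar>u x\<bar>"
      by eventually_elim (auto simp: abs_mult intro!: mult_left_le_one_le)
    have "\<bar>\<integral>x. v x * u x \<partial>\<mu>\<bar> \<le> (\<integral>x. \<bar>v x * u x\<bar> \<partial>\<mu>)" by (rule integral_abs_bound)
    also have "\<dots> \<le> L1_norm \<mu> u"
      unfolding L1_norm_def using vi[OF u] int[OF u] le by (intro integral_mono_AE) auto
    finally show ?thesis using C[OF u] by linarith
  qed
  then show ?thesis
    unfolding V_dual_def dual_space_def functional_of_def
    by (auto simp: V_add V_scale distrib_left vi mult.left_commute)
qed

lemma dual_space_linear:
  assumes "\<phi> \<in> V_dual \<mu> V E"
  shows "f \<in> V \<Longrightarrow> g \<in> V \<Longrightarrow> \<phi> (\<lambda>x. f x + g x) = \<phi> f + \<phi> g"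
    and "f \<in> V \<Longrightarrow> \<phi> (\<lambda>x. c * f x) = c * \<phi> f"
    and "f \<notin> V \<Longrightarrow> \<phi> f = 0"
  using assms unfolding V_dual_def dual_space_def by blast+

text \<open>
  \<open>normal_fns q\<close> is the normal cone of \<open>M\<close> at \<open>q\<close>, with \<open>V\<close> in place of its bidual.
\<close>

definition normal_fns :: "('a \<Rightarrow> real) \<Rightarrow> ('a \<Rightarrow> real) set"
  where "normal_fns q = {z \<in> V. \<forall>v\<in>M_set \<mu>. functional_of \<mu> V v z \<le> functional_of \<mu> V q z}"

lemma normal_fns_AE:
  assumes emb: "embeds_continuously_densely_L1 \<mu> V E" and q: "q \<in> M_set \<mu>"
    and z: "z \<in> normal_fns q"
  shows "AE x in \<mu>. q x * z x = \<bar>z x\<bar>"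
proof (rule maximizer_AE[OF q])
  show "integrable \<mu> z"
    using z emb by (auto simp: normal_fns_def embeds_continuously_densely_L1_def L1_def)
qed (use z in \<open>auto simp: normal_fns_def functional_of_def\<close>)

text \<open>For every \<open>v\<close> in \<open>M_set \<mu>\<close> the difference of the
  functionals of \<open>v\<close> and \<open>q\<close> is a radial direction with factor 1, hence
  tangent, and the normal functional is nonpositive on it.\<close>

lemma normal_cone_imp_normal_fns:
  assumes emb: "embeds_continuously_densely_L1 \<mu> V E" and q: "q \<in> M_set \<mu>" and y: "y \<in> V"
    and nc: "bidual_embedding V (E1_norm \<mu> E) y
       \<in> normal_cone (V_dual \<mu> V E) (V_dual_norm \<mu> V E) (M_dual \<mu> V) (functional_of \<mu> V q)"
  shows "y \<in> normal_fns q"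
proof -
  have "functional_of \<mu> V v y \<le> functional_of \<mu> V q y" if v: "v \<in> M_set \<mu>" for v
  proof -
    let ?h = "\<lambda>f. functional_of \<mu> V v f - functional_of \<mu> V q f"
    obtain a where a: "a \<in> V" "H.riesz a = functional_of \<mu> V v"
      using H.riesz_surj functional_of_mem_dual[OF emb v] unfolding V_dual_def by blast
    obtain b where b: "b \<in> V" "H.riesz b = functional_of \<mu> V q"
      using H.riesz_surj functional_of_mem_dual[OF emb q] unfolding V_dual_def by blast
    \<comment> \<open>The difference of two functionals is represented by the difference of their
      Riesz vectors, which gives membership in the dual.\<close>
    have hd: "?h \<in> V_dual \<mu> V E"
      using H.riesz_mem_dual[OF H.diff_mem[OF a(1) b(1)]] H.riesz_diff[OF a(1) b(1)] a(2) b(2)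
      by (simp add: V_dual_def)
    have "V_dual_norm \<mu> V E (\<lambda>f. 0) \<le> 0"
      unfolding V_dual_norm_def dual_norm_def
      by (rule cSUP_least) (use V_zero H.B_zero[OF V_zero] in \<open>auto simp: E1_norm_def\<close>)
    moreover have "?h \<in> radial_cone (M_dual \<mu> V) (functional_of \<mu> V q)"
      unfolding radial_cone_def M_dual_def using v by (force intro: exI[of _ 1])
    ultimately have "?h \<in> tangent_cone (V_dual \<mu> V E) (V_dual_norm \<mu> V E) (M_dual \<mu> V) (functional_of \<mu> V q)"
      unfolding tangent_cone_def closure_in_def using hd by (auto intro!: bexI[of _ ?h])
    then have "bidual_embedding V (E1_norm \<mu> E) y ?h \<le> 0"
      using nc unfolding normal_cone_def by blast
    then show ?thesis using hd by (simp add: bidual_embedding_def V_dual_def)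
  qed
  with y show ?thesis by (simp add: normal_fns_def)
qed

lemma normal_fns_cone:
  assumes emb: "embeds_continuously_densely_L1 \<mu> V E" and q: "q \<in> M_set \<mu>"
  shows "(\<lambda>x. 0) \<in> normal_fns q"
    and "z \<in> normal_fns q \<Longrightarrow> w \<in> normal_fns q \<Longrightarrow> (\<lambda>x. z x + w x) \<in> normal_fns q"
    and "0 \<le> t \<Longrightarrow> z \<in> normal_fns q \<Longrightarrow> (\<lambda>x. t * z x) \<in> normal_fns q"
proof -
  note lin = dual_space_linear[OF functional_of_mem_dual[OF emb]]
  show "(\<lambda>x. 0) \<in> normal_fns q" by (simp add: normal_fns_def V_zero functional_of_def)
  show "(\<lambda>x. z x + w x) \<in> normal_fns q" if "z \<in> normal_fns q" "w \<in> normal_fns q"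
    using that unfolding normal_fns_def by (auto simp: lin q V_add intro: add_mono)
  show "(\<lambda>x. t * z x) \<in> normal_fns q" if "0 \<le> t" "z \<in> normal_fns q"
    using that unfolding normal_fns_def by (auto simp: lin q V_scale intro: mult_left_mono)
qed

text \<open>
  The bipolar argument in \<open>V\<^sup>*\<close>: the tangent cone is the polar of the normal cone.
\<close>

lemma riesz_mem_tangent_cone:
  assumes emb: "embeds_continuously_densely_L1 \<mu> V E" and q: "q \<in> M_set \<mu>" and n: "n \<in> V"
    and polar: "\<And>z. z \<in> normal_fns q \<Longrightarrow> E1 \<mu> E n z \<le> 0"
  shows "H.riesz n \<in> tangent_cone (V_dual \<mu> V E) (V_dual_norm \<mu> V E) (M_dual \<mu> V) (functional_of \<mu> V q)"
proof -
  let ?F = "functional_of \<mu> V"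
  \<comment> \<open>The preimage of the radial cone under the Riesz map, so that separation can be
    carried out in \<open>V\<close>.\<close>
  define R where "R = {f \<in> V. \<exists>t v. 0 < t \<and> v \<in> M_set \<mu> \<and> H.riesz f = (\<lambda>g. t * (?F v g - ?F q g))}"
  have Rexp: "H.riesz f g = E1 \<mu> E f g" if "g \<in> V" for f g using that by (simp add: H.riesz_def)
  note int = V_integrable[OF emb]
  have R0: "(\<lambda>x. 0) \<in> R"
    unfolding R_def using q H.B_zero V_zero by (auto intro!: exI[of _ 1] exI[of _ q] simp: H.riesz_def)
  have Rscale: "(\<lambda>x. s * f x) \<in> R" if s: "0 < s" and f: "f \<in> R" for s f
  proof -
    obtain t v where tv: "f \<in> V" "0 < t" "v \<in> M_set \<mu>" "H.riesz f = (\<lambda>g. t * (?F v g - ?F q g))"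
      using f unfolding R_def by blast
    have "H.riesz (\<lambda>x. s * f x) = (\<lambda>g. (s * t) * (?F v g - ?F q g))"
    proof
      fix g show "H.riesz (\<lambda>x. s * f x) g = (s * t) * (?F v g - ?F q g)"
        using fun_cong[OF tv(4), of g] tv(1)
        by (auto simp: H.riesz_def H.B_scale functional_of_def)
    qed
    moreover have "0 < s * t" using s tv by simp
    ultimately show ?thesis unfolding R_def using tv V_scale by blast
  qed
  have Radd: "(\<lambda>x. f x + g x) \<in> R" if f: "f \<in> R" and g: "g \<in> R" for f g
  proof -
    obtain t v where tv: "f \<in> V" "0 < t" "v \<in> M_set \<mu>" "H.riesz f = (\<lambda>g. t * (?F v g - ?F q g))"
      using f unfolding R_def by blast
    obtain s w where sw: "g \<in> V" "0 < s" "w \<in> M_set \<mu>" "H.riesz g = (\<lambda>g. s * (?F w g - ?F q g))"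
      using g unfolding R_def by blast
    \<comment> \<open>With these weights, \<open>t (v - q) + s (w - q)\<close> equals
      \<open>(t + s) (?v - q)\<close>, a single radial direction.\<close>
    let ?v = "\<lambda>x. (t / (t + s)) * v x + (s / (t + s)) * w x"
    have vM: "?v \<in> M_set \<mu>"
      using tv sw by (intro M_set_convex) (auto simp flip: add_divide_distrib)
    have "H.riesz (\<lambda>x. f x + g x) h = (t + s) * (?F ?v h - ?F q h)" for h
    proof (cases "h \<in> V")
      case True
      have "?F ?v h = (t / (t + s)) * ?F v h + (s / (t + s)) * ?F w h"
        using True M_set_mult_integrable[OF tv(3) int[OF True]] M_set_mult_integrable[OF sw(3) int[OF True]]
        by (simp add: functional_of_def distrib_right mult.assoc)
      then have "(t + s) * ?F ?v h = t * ?F v h + s * ?F w h" using tv(2) sw(2)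
        by (simp add: distrib_left)
      moreover have "H.riesz (\<lambda>x. f x + g x) h = H.riesz f h + H.riesz g h"
        using True tv(1) sw(1) by (simp add: H.riesz_def H.B_add)
      ultimately show ?thesis using tv(4) sw(4) by (simp add: algebra_simps)
    qed (simp add: H.riesz_def functional_of_def)
    then have "H.riesz (\<lambda>x. f x + g x) = (\<lambda>h. (t + s) * (?F ?v h - ?F q h))" by blast
    moreover have "0 < t + s" using tv sw by simp
    ultimately show ?thesis unfolding R_def using vM V_add[OF tv(1) sw(1)] by blast
  qed
  have "\<exists>f\<in>R. E1_norm \<mu> E (\<lambda>x. n x - f x) < \<epsilon>" if e: "0 < \<epsilon>" for \<epsilon>
  proof (rule ccontr)
    assume "\<not> ?thesis"
    then have far: "\<And>f. f \<in> R \<Longrightarrow> \<epsilon> \<le> E1_norm \<mu> E (\<lambda>x. n x - f x)" by force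
    have RV: "R \<subseteq> V" by (auto simp: R_def)
    obtain m where m: "m \<in> V" "\<And>f. f \<in> R \<Longrightarrow> E1 \<mu> E m f \<le> 0" "0 < E1 \<mu> E m n"
      by (rule H.cone_separation[OF RV R0 Radd Rscale n e far]) blast+
    \<comment> \<open>The separating vector is nonpositive on every direction from \<open>q\<close>
      to a point of the ball, so it is normal, and \<open>polar\<close> contradicts
      \<open>0 < E1 \<mu> E m n\<close>.\<close>
    have "m \<in> normal_fns q"
      unfolding normal_fns_def
    proof (intro CollectI conjI ballI m(1))
      fix v assume v: "v \<in> M_set \<mu>"
      obtain a where a: "a \<in> V" "H.riesz a = ?F v"
        using H.riesz_surj functional_of_mem_dual[OF emb v] unfolding V_dual_def by blast
      obtain b where b: "b \<in> V" "H.riesz b = ?F q"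
        using H.riesz_surj functional_of_mem_dual[OF emb q] unfolding V_dual_def by blast
      have eq: "H.riesz (\<lambda>x. a x - b x) = (\<lambda>g. 1 * (?F v g - ?F q g))"
        using H.riesz_diff[OF a(1) b(1)] a(2) b(2) by simp
      then have "(\<lambda>x. a x - b x) \<in> R"
        unfolding R_def using v H.diff_mem[OF a(1) b(1)] zero_less_one by blast
      from m(2)[OF this] have "E1 \<mu> E (\<lambda>x. a x - b x) m \<le> 0"
        using H.B_sym[OF m(1) H.diff_mem[OF a(1) b(1)]] by simp
      then show "?F v m \<le> ?F q m" using fun_cong[OF eq, of m] Rexp[OF m(1)] by simp
    qed
    then show False using polar[of m] m(3) H.B_sym[OF n m(1)] by simp
  qed
  note approx = this
  have "\<exists>a\<in>radial_cone (M_dual \<mu> V) (?F q). V_dual_norm \<mu> V E (\<lambda>x. H.riesz n x - a x) < \<epsilon>"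
    if e: "0 < \<epsilon>" for \<epsilon>
  proof -
    obtain f where f: "f \<in> R" "E1_norm \<mu> E (\<lambda>x. n x - f x) < \<epsilon>" using approx[OF e] by blast
    then have fV: "f \<in> V" by (simp add: R_def)
    have "H.riesz f \<in> radial_cone (M_dual \<mu> V) (?F q)"
      using f(1) unfolding R_def radial_cone_def M_dual_def by blast
    moreover have "V_dual_norm \<mu> V E (\<lambda>x. H.riesz n x - H.riesz f x) < \<epsilon>"
      using H.dual_norm_riesz_le[OF H.diff_mem[OF n fV]] f(2) H.riesz_diff[OF n fV]
      by (simp add: V_dual_norm_def)
    ultimately show ?thesis by blast
  qed
  then show ?thesis
    unfolding tangent_cone_def closure_in_def using H.riesz_mem_dual[OF n] by (simp add: V_dual_def)
qed

section \<open>Consequences of polyhedricity\<close>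

text \<open>If \<open>t (v - q)\<close> is annihilated by \<open>y\<close>, then \<open>v\<close>
  and \<open>q\<close> both carry the sign of \<open>y\<close> where \<open>y\<close> is nonzero,
  hence agree almost everywhere on \<open>U\<close>, and the direction vanishes on functions
  supported there. The dual norm bound carries this over to the closure.\<close>

lemma closure_radial_annihilator_vanishes:
  assumes emb: "embeds_continuously_densely_L1 \<mu> V E" and q: "q \<in> M_set \<mu>"
    and yN: "y \<in> normal_fns q"
    and y0: "AE x in \<mu>. x \<in> U \<longrightarrow> y x \<noteq> 0"
    and u: "u \<in> V" "AE x in \<mu>. x \<notin> U \<longrightarrow> u x = 0"
    and \<xi>: "\<xi> \<in> closure_in (V_dual \<mu> V E) (V_dual_norm \<mu> V E)
      (radial_cone (M_dual \<mu> V) (functional_of \<mu> V q) \<inter>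
       annihilator (V_dual \<mu> V E) (bidual_embedding V (E1_norm \<mu> E) y))"
  shows "\<xi> u = 0"
proof -
  have y: "y \<in> V" using yN by (simp add: normal_fns_def)
  note int = V_integrable[OF emb]
  have r0: "r u = 0" if r: "r \<in> radial_cone (M_dual \<mu> V) (functional_of \<mu> V q)"
    and ra: "r \<in> annihilator (V_dual \<mu> V E) (bidual_embedding V (E1_norm \<mu> E) y)" for r
  proof -
    obtain t v where t: "0 < t" and v: "v \<in> M_set \<mu>"
      and req: "r = (\<lambda>g. t * (functional_of \<mu> V v g - functional_of \<mu> V q g))"
      using r unfolding radial_cone_def M_dual_def by blast
    have "r y = 0" using ra by (auto simp: annihilator_def bidual_embedding_def V_dual_def)
    then have vq: "functional_of \<mu> V v y = functional_of \<mu> V q y" using t by (simp add: req)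
    \<comment> \<open>Having the same pairing with \<open>y\<close> as \<open>q\<close>, the
      function \<open>v\<close> is a maximizer as well.\<close>
    have vy: "AE x in \<mu>. v x * y x = \<bar>y x\<bar>"
      using yN v vq int[OF y] by (intro maximizer_AE) (auto simp: normal_fns_def functional_of_def)
    have "AE x in \<mu>. v x * u x = q x * u x"
      using vy normal_fns_AE[OF emb q yN] y0 u(2)
    proof eventually_elim
      case (elim x)
      show ?case
      proof (cases "x \<in> U")
        case True
        then have "v x = q x" using elim mult_right_cancel[of "y x" "v x" "q x"] by simp
        then show ?thesis by simp
      qed (use elim in simp)
    qed
    then have "(\<integral>x. v x * u x \<partial>\<mu>) = (\<integral>x. q x * u x \<partial>\<mu>)"
      using M_set_mult_integrable[OF v int[OF u(1)]] M_set_mult_integrable[OF q int[OF u(1)]]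
      by (intro integral_cong_AE borel_measurable_integrable)
    then show ?thesis using u by (simp add: req functional_of_def)
  qed
  have \<xi>V: "\<xi> \<in> V_dual \<mu> V E" using \<xi> by (simp add: closure_in_def)
  have bound: "\<bar>\<xi> u\<bar> \<le> \<epsilon> * E1_norm \<mu> E u" if e: "0 < \<epsilon>" for \<epsilon>
  proof -
    obtain r where r: "r \<in> radial_cone (M_dual \<mu> V) (functional_of \<mu> V q)"
      and ra: "r \<in> annihilator (V_dual \<mu> V E) (bidual_embedding V (E1_norm \<mu> E) y)"
      and close: "V_dual_norm \<mu> V E (\<lambda>f. \<xi> f - r f) < \<epsilon>"
      using \<xi> e unfolding closure_in_def by blast
    have rV: "r \<in> V_dual \<mu> V E" using ra by (simp add: annihilator_def)
    obtain a where a: "a \<in> V" "H.riesz a = \<xi>" using H.riesz_surj \<xi>V unfolding V_dual_def by blast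
    obtain b where b: "b \<in> V" "H.riesz b = r" using H.riesz_surj rV unfolding V_dual_def by blast
    have "(\<lambda>f. \<xi> f - r f) \<in> dual_space V (E1_norm \<mu> E)"
      using H.riesz_mem_dual[OF H.diff_mem[OF a(1) b(1)]] H.riesz_diff[OF a(1) b(1)] a(2) b(2) by simp
    from H.dual_norm_bound[OF this u(1)] have "\<bar>\<xi> u\<bar> \<le> V_dual_norm \<mu> V E (\<lambda>f. \<xi> f - r f) * E1_norm \<mu> E u"
      using r0[OF r ra] by (simp add: V_dual_norm_def)
    also have "\<dots> \<le> \<epsilon> * E1_norm \<mu> E u"
      using close H.nrm_nonneg[OF u(1)] by (intro mult_right_mono) auto
    finally show ?thesis .
  qed
  \<comment> \<open>Adding 1 to the norm avoids division by zero when \<open>u\<close> has norm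
    zero.\<close>
  have "\<bar>\<xi> u\<bar> \<le> 0 + e" if "0 < e" for e
  proof -
    have p: "0 < E1_norm \<mu> E u + 1" using H.nrm_nonneg[OF u(1)] by linarith
    have "\<bar>\<xi> u\<bar> \<le> e / (E1_norm \<mu> E u + 1) * E1_norm \<mu> E u" using that p by (intro bound) simp
    also have "\<dots> \<le> e" using that p by (simp add: field_simps)
    finally show ?thesis by simp
  qed
  then show ?thesis using field_le_epsilon[of "\<bar>\<xi> u\<bar>" 0] by auto
qed

text \<open>Otherwise some \<open>n\<close> separates \<open>u\<close> from the cone
  \<open>C\<close>. Its Riesz functional is tangent and annihilated by \<open>y\<close>, so
  polyhedricity places it in the closure of the annihilated radial directions; it then vanishes at
  \<open>u\<close>, against strict separation.\<close>

lemma polyhedric_imp_approximation: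
  assumes emb: "embeds_continuously_densely_L1 \<mu> V E" and q: "q \<in> M_set \<mu>"
    and yN: "y \<in> normal_fns q"
    and y0: "AE x in \<mu>. x \<in> U \<longrightarrow> y x \<noteq> 0"
    and u: "u \<in> V" "AE x in \<mu>. x \<notin> U \<longrightarrow> u x = 0"
    and poly: "polyhedric_at (V_dual \<mu> V E) (V_dual_norm \<mu> V E) (M_dual \<mu> V) (functional_of \<mu> V q)
           (bidual_embedding V (E1_norm \<mu> E) y)"
    and e: "0 < \<epsilon>"
  obtains z t where "z \<in> normal_fns q" "0 \<le> t" "E1_norm \<mu> E (\<lambda>x. u x - (z x - t * y x)) < \<epsilon>"
proof -
  define C where "C = {(\<lambda>x. z x - t * y x) | z t. z \<in> normal_fns q \<and> 0 \<le> t}"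
  note cone = normal_fns_cone[OF emb q]
  have y: "y \<in> V" using yN by (simp add: normal_fns_def)
  have CI: "(\<lambda>x. z x - t * y x) \<in> C" if "z \<in> normal_fns q" "0 \<le> t" for z t
    using that unfolding C_def by blast
  have CV: "C \<subseteq> V" unfolding C_def normal_fns_def using H.diff_mem V_scale[OF y] by blast
  have C0: "(\<lambda>x. 0) \<in> C" using CI[OF cone(1), of 0] by simp
  have Cadd: "(\<lambda>x. a x + b x) \<in> C" if "a \<in> C" "b \<in> C" for a b
  proof -
    obtain z t w s where *: "z \<in> normal_fns q" "0 \<le> t" "a = (\<lambda>x. z x - t * y x)"
      "w \<in> normal_fns q" "0 \<le> s" "b = (\<lambda>x. w x - s * y x)" using \<open>a \<in> C\<close> \<open>b \<in> C\<close> unfolding C_def by blast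
    have "(\<lambda>x. (z x + w x) - (t + s) * y x) \<in> C"
      using * by (intro CI cone) auto
    then show ?thesis using * by (simp add: algebra_simps)
  qed
  have Cscale: "(\<lambda>x. r * a x) \<in> C" if "0 < r" "a \<in> C" for r a
  proof -
    obtain z t where *: "z \<in> normal_fns q" "0 \<le> t" "a = (\<lambda>x. z x - t * y x)"
      using \<open>a \<in> C\<close> unfolding C_def by blast
    have "(\<lambda>x. r * z x - (r * t) * y x) \<in> C" using * that(1) by (intro CI cone) auto
    then show ?thesis using * by (simp add: algebra_simps)
  qed
  have "\<exists>c\<in>C. E1_norm \<mu> E (\<lambda>x. u x - c x) < \<epsilon>"
  proof (rule ccontr)
    assume "\<not> ?thesis"
    then have far: "\<And>c. c \<in> C \<Longrightarrow> \<epsilon> \<le> E1_norm \<mu> E (\<lambda>x. u x - c x)" by force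
    obtain n where n: "n \<in> V" and nC: "\<And>c. c \<in> C \<Longrightarrow> E1 \<mu> E n c \<le> 0" and pos: "0 < E1 \<mu> E n u"
      by (rule H.cone_separation[OF CV C0 Cadd Cscale u(1) e far]) blast+
    have nN: "E1 \<mu> E n z \<le> 0" if "z \<in> normal_fns q" for z using nC[OF CI[OF that, of 0]] by simp
    \<comment> \<open>As \<open>y\<close> is itself normal and \<open>- y\<close> lies in
      \<open>C\<close>, the vector \<open>n\<close> is orthogonal to \<open>y\<close>.\<close>
    have "E1 \<mu> E n (\<lambda>x. - y x) \<le> 0" using nC[OF CI[OF cone(1), of 1]] by simp
    then have ny: "E1 \<mu> E n y = 0" using nN[OF yN] H.B_minus_right[OF y n] by simp
    have nd: "H.riesz n \<in> V_dual \<mu> V E" using H.riesz_mem_dual[OF n] by (simp add: V_dual_def)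
    then have "H.riesz n \<in> annihilator (V_dual \<mu> V E) (bidual_embedding V (E1_norm \<mu> E) y)"
      using ny y by (simp add: annihilator_def bidual_embedding_def V_dual_def H.riesz_def)
    then have "H.riesz n \<in> closure_in (V_dual \<mu> V E) (V_dual_norm \<mu> V E)
      (radial_cone (M_dual \<mu> V) (functional_of \<mu> V q) \<inter>
       annihilator (V_dual \<mu> V E) (bidual_embedding V (E1_norm \<mu> E) y))"
      using riesz_mem_tangent_cone[OF emb q n nN] poly unfolding polyhedric_at_def by blast
    from closure_radial_annihilator_vanishes[OF emb q yN y0 u this] pos u(1)
    show False by (simp add: H.riesz_def)
  qed
  then show ?thesis using that unfolding C_def by blast
qed

end

section \<open>Capacity of the zero set\<close>

text \<open>Lindelof argument with balls of radii \<open>inverse (real (Suc k))\<close> about a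
  countable dense set.\<close>

lemma separable_countable_cover:
  fixes U :: "'a::metric_space set"
  assumes sep: "separable_space (euclidean :: 'a topology)"
    and loc: "\<And>x. x \<in> U \<Longrightarrow> \<exists>S. open S \<and> x \<in> S \<and> P S"
    and down: "\<And>S T. S \<subseteq> T \<Longrightarrow> P T \<Longrightarrow> P S" and empty: "P {}"
  shows "\<exists>A :: nat \<Rightarrow> 'a set. U \<subseteq> (\<Union>n. A n) \<and> (\<forall>n. P (A n))"
proof -
  obtain D :: "'a set" where D: "countable D" "closure D = UNIV"
    using sep unfolding separable_space_def by auto
  then have ne: "D \<times> (UNIV :: nat set) \<noteq> {}" by auto
  define b :: "'a \<times> nat \<Rightarrow> 'a set" where "b = (\<lambda>(d, k). ball d (inverse (real (Suc k))))"
  \<comment> \<open>Balls without the property are replaced by the empty set, so that the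
    enumeration is total.\<close>
  define A where "A n = (let S = b (from_nat_into (D \<times> UNIV) n) in if P S then S else {})" for n
  have "x \<in> (\<Union>n. A n)" if x: "x \<in> U" for x
  proof -
    obtain S where S: "open S" "x \<in> S" "P S" using loc[OF x] by blast
    obtain r where r: "0 < r" "ball x r \<subseteq> S" using S open_contains_ball by blast
    obtain k where k: "inverse (real (Suc k)) < r / 2" using reals_Archimedean[of "r / 2"] r(1) by auto
    obtain d where d: "d \<in> D" "dist d x < inverse (real (Suc k))"
      using D(2) closure_approachable[of x D] by (metis UNIV_I inverse_positive_iff_positive of_nat_0_less_iff zero_less_Suc)
    have "b (d, k) \<subseteq> ball x r"
    proof
      fix p assume "p \<in> b (d, k)"
      then have "dist d p < inverse (real (Suc k))" by (simp add: b_def)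
      moreover have "dist x p \<le> dist d x + dist d p" by (rule dist_triangle3)
      ultimately have "dist x p < r" using k d(2) by argo
      then show "p \<in> ball x r" by simp
    qed
    then have P: "P (b (d, k))" using down[OF _ S(3)] r(2) by blast
    have "(d, k) \<in> range (from_nat_into (D \<times> UNIV))"
      using range_from_nat_into[OF ne] D(1) d(1) by simp
    then obtain n where "from_nat_into (D \<times> UNIV) n = (d, k)" by (metis imageE)
    then have "A n = b (d, k)" using P by (simp add: A_def)
    moreover have "x \<in> b (d, k)" using d by (simp add: b_def)
    ultimately show ?thesis by blast
  qed
  moreover have "P (A n)" for n using empty by (simp add: A_def Let_def)
  ultimately show ?thesis by blast
qed

text \<open>The complement is the preimage of a closed set under a map continuous on the closed set
  \<open>- G\<close>. Applied to the quasi-continuous representative, this supplies the open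
  neighborhoods that capacity asks for.\<close>

lemma open_sublevel_Un:
  fixes f :: "'a::topological_space \<Rightarrow> real"
  assumes "open G" "continuous_on (- G) f"
  shows "open ({x. \<bar>f x\<bar> < d} \<union> G)"
proof -
  have "closed (- G \<inter> f -` ({..- d} \<union> {d..}))"
    using assms by (intro continuous_closed_preimage) auto
  moreover have "- (- G \<inter> f -` ({..- d} \<union> {d..})) = {x. \<bar>f x\<bar> < d} \<union> G" by auto
  ultimately show ?thesis by (metis open_Compl)
qed

lemma (in dirichlet_space) E1_norm_truncation_scale_le:
  assumes "f \<in> V"
  shows "E1_norm \<mu> E (unit_truncation (\<lambda>x. c * f x)) \<le> \<bar>c\<bar> * E1_norm \<mu> E f"
  using E1_norm_unit_truncation_le[OF V_scale[OF assms]] H.nrm_scale[OF assms] by metis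

text \<open>
  On \<open>U\<close> the functions \<open>y\<close>, \<open>z\<close> and \<open>w\<close> share the sign \<open>q\<close>. So the approximants \<open>z - t y\<close> of \<open>u\<close>
  and \<open>w - s y\<close> of \<open>-u\<close> cannot both be accurate where \<open>y\<close> is small and \<open>u > c\<close>; the two
  truncated errors together are at least \<open>1\<close> there.
\<close>

lemma sign_conflict:
  fixes q y z w u s t c d :: real
  assumes sgn: "q * y = \<bar>y\<bar>" "q * z = \<bar>z\<bar>" "q * w = \<bar>w\<bar>" and y: "y \<noteq> 0" "\<bar>y\<bar> < d"
    and st: "0 \<le> s" "0 \<le> t" and d: "d * (s + t) \<le> c / 2" and u: "c < u" "0 < c"
  shows "1 \<le> 2 / c * (u - (z - t * y)) \<or> 1 \<le> - 2 / c * (- u - (w - s * y))"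
proof (cases "0 < y")
  case True
  then have "q = 1" using sgn(1) mult_right_cancel[of y q 1] by simp
  then have "0 \<le> w" using sgn(3) by simp
  moreover have "s * y \<le> c / 2"
  proof -
    have "s * y \<le> d * (s + t)" using True y st
      by (smt (verit) mult.commute mult_left_mono mult_nonneg_nonneg)
    then show ?thesis using d by linarith
  qed
  ultimately have "c / 2 \<le> u + w - s * y" using u by argo
  then have "1 \<le> - 2 / c * (- u - (w - s * y))" using u by (simp add: field_simps)
  then show ?thesis ..
next
  case False
  then have neg: "y < 0" using y by simp
  then have "q = -1" using sgn(1) mult_right_cancel[of y q "-1"] by simp
  then have "z \<le> 0" using sgn(2) by simp
  moreover have "t * - y \<le> c / 2"
  proof -
    have "t * - y \<le> d * (s + t)" using neg y st
      by (smt (verit) mult.commute mult_left_mono mult_nonneg_nonneg)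
    then show ?thesis using d by linarith
  qed
  ultimately have "c / 2 \<le> u - z + t * y" using u by argo
  then have "1 \<le> 2 / c * (u - (z - t * y))" using u by (simp add: field_simps)
  then show ?thesis ..
qed

text \<open>The test function is the sum of the two scaled and truncated approximation errors and of
  a truncated test function for the exceptional set of \<open>y_qc\<close>. By the sign conflict it
  is at least 1 almost everywhere near the zero set.\<close>

lemma (in regular_dirichlet_space) capacity_zero_set_null:
  assumes emb: "embeds_continuously_densely_L1 \<mu> V E" and q: "q \<in> M_set \<mu>"
    and yN: "y \<in> normal_fns q" and qc: "quasi_continuous_rep \<mu> V E y y_qc"
    and y0: "AE x in \<mu>. x \<in> U \<longrightarrow> y x \<noteq> 0"
    and u: "u \<in> V" "continuous_on UNIV u" and c: "0 < c" "{x. c < u x} \<subseteq> U"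
    and approx: "\<And>\<epsilon>. 0 < \<epsilon> \<Longrightarrow> \<exists>z\<in>normal_fns q. \<exists>t\<ge>0. E1_norm \<mu> E (\<lambda>x. u x - (z x - t * y x)) < \<epsilon>"
    and approx_minus:
      "\<And>\<epsilon>. 0 < \<epsilon> \<Longrightarrow> \<exists>w\<in>normal_fns q. \<exists>s\<ge>0. E1_norm \<mu> E (\<lambda>x. - u x - (w x - s * y x)) < \<epsilon>"
  shows "capacity \<mu> V E ({x. y_qc x = 0} \<inter> {x. c < u x}) = 0"
proof -
  let ?A = "{x. y_qc x = 0} \<inter> {x. c < u x}"
  have y: "y \<in> V" using yN by (simp add: normal_fns_def)
  have "capacity \<mu> V E ?A \<le> 0 + ennreal \<epsilon>" if \<epsilon>: "0 < \<epsilon>" for \<epsilon> :: real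
  proof -
    \<comment> \<open>Each of the three summands gets norm at most \<open>r\<close>.\<close>
    define r where "r = sqrt \<epsilon> / 3"
    have r: "0 < r" using \<epsilon> by (simp add: r_def)
    \<comment> \<open>The factor \<open>c / 2\<close> compensates for the scaling of the errors by
      \<open>2 / c\<close> or \<open>- 2 / c\<close>.\<close>
    have cr: "0 < c / 2 * r" using c r by simp
    obtain z t where z: "z \<in> normal_fns q" "0 \<le> t"
      and zt: "E1_norm \<mu> E (\<lambda>x. u x - (z x - t * y x)) < c / 2 * r" using approx[OF cr] by blast
    obtain w s where w: "w \<in> normal_fns q" "0 \<le> s"
      and ws: "E1_norm \<mu> E (\<lambda>x. - u x - (w x - s * y x)) < c / 2 * r" using approx_minus[OF cr] by blast
    define f where "f x = u x - (z x - t * y x)" for x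
    define g where "g x = - u x - (w x - s * y x)" for x
    have zV: "z \<in> V" "w \<in> V" using z w by (auto simp: normal_fns_def)
    have fV: "f \<in> V" unfolding f_def by (intro H.diff_mem u V_scale y zV)
    have gV: "g \<in> V" unfolding g_def by (intro H.diff_mem H.minus_mem u V_scale y zV)
    \<comment> \<open>Chosen after \<open>s\<close> and \<open>t\<close>, over whose size there is
      no control; adding 1 keeps the denominator positive.\<close>
    define d where "d = c / (2 * (s + t + 1))"
    have d: "0 < d" "d * (s + t) \<le> c / 2" using c w z by (auto simp: d_def field_simps)
    have "quasi_continuous \<mu> V E y_qc" using qc by (simp add: quasi_continuous_rep_def)
    moreover have "0 < r\<^sup>2" using r by simp
    ultimately obtain G0 where G0: "open G0" "capacity \<mu> V E G0 < ennreal (r\<^sup>2)" "continuous_on (- G0) y_qc"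
      unfolding quasi_continuous_def by blast
    \<comment> \<open>The exceptional set is enlarged to an open \<open>G\<close> on which
      \<open>e\<close> is at least 1 almost everywhere, so \<open>G\<close> can be absorbed into the
      neighborhood \<open>?W\<close>.\<close>
    obtain e G where e: "e \<in> V" "open G" "G0 \<subseteq> G" "AE x in \<mu>. x \<in> G \<longrightarrow> 1 \<le> e x" "E1 \<mu> E e e < r\<^sup>2"
      by (rule capacity_lessE[OF G0(2)])
    have en: "E1_norm \<mu> E e \<le> r" using e(5) r unfolding E1_norm_def by (intro real_le_lsqrt) auto
    define v1 where "v1 = unit_truncation (\<lambda>x. 2 / c * f x)"
    define v2 where "v2 = unit_truncation (\<lambda>x. - 2 / c * g x)"
    define v3 where "v3 = unit_truncation e"
    have V123: "v1 \<in> V" "v2 \<in> V" "v3 \<in> V"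
      using fV gV e(1) unfolding v1_def v2_def v3_def by (intro unit_truncation_mem V_scale; simp)+
    define v where "v x = v1 x + v2 x + v3 x" for x
    have V12: "(\<lambda>x. v1 x + v2 x) \<in> V" using V123 V_add by blast
    have vV: "v \<in> V" using V_add[OF V12 V123(3)] by (simp add: v_def[abs_def])
    have v1n: "E1_norm \<mu> E v1 \<le> r"
    proof -
      have "E1_norm \<mu> E v1 \<le> 2 / c * E1_norm \<mu> E f"
        using E1_norm_truncation_scale_le[OF fV, of "2 / c"] c by (simp add: v1_def)
      also have "\<dots> \<le> 2 / c * (c / 2 * r)"
        using zt c by (intro mult_left_mono) (auto simp: f_def[abs_def])
      finally show ?thesis using c by simp
    qed
    have v2n: "E1_norm \<mu> E v2 \<le> r"
    proof -
      have "E1_norm \<mu> E v2 \<le> 2 / c * E1_norm \<mu> E g"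
        using E1_norm_truncation_scale_le[OF gV, of "- 2 / c"] c by (simp add: v2_def)
      also have "\<dots> \<le> 2 / c * (c / 2 * r)"
        using ws c by (intro mult_left_mono) (auto simp: g_def[abs_def])
      finally show ?thesis using c by simp
    qed
    have v3n: "E1_norm \<mu> E v3 \<le> r"
      using E1_norm_unit_truncation_le[OF e(1)] en by (simp add: v3_def)
    have "E1_norm \<mu> E v \<le> E1_norm \<mu> E v1 + E1_norm \<mu> E v2 + E1_norm \<mu> E v3"
      using H.nrm_add[OF V12 V123(3)] H.nrm_add[OF V123(1,2)] by (simp add: v_def[abs_def])
    then have "E1_norm \<mu> E v \<le> sqrt \<epsilon>" using v1n v2n v3n by (simp add: r_def)
    then have vE: "E1 \<mu> E v v \<le> \<epsilon>" by (simp add: E1_norm_def)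
    let ?W = "({x. \<bar>y_qc x\<bar> < d} \<union> G) \<inter> {x. c < u x}"
    have "continuous_on (- G) y_qc" using G0(3) e(3) by (rule_tac continuous_on_subset) auto
    then have "open ({x. \<bar>y_qc x\<bar> < d} \<union> G)" by (rule open_sublevel_Un[OF e(2)])
    moreover have "open {x. c < u x}" by (intro open_Collect_less u continuous_intros)
    ultimately have W: "open ?W" by (rule open_Int)
    have "AE x in \<mu>. y_qc x = y x" using qc by (simp add: quasi_continuous_rep_def)
    then have one: "AE x in \<mu>. x \<in> ?W \<longrightarrow> 1 \<le> v x"
      using y0 e(4) normal_fns_AE[OF emb q yN] normal_fns_AE[OF emb q z(1)] normal_fns_AE[OF emb q w(1)]
    proof eventually_elim
      case (elim x)
      have nn: "0 \<le> v1 x" "0 \<le> v2 x" "0 \<le> v3 x" by (simp_all add: v1_def v2_def v3_def unit_truncation_def)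
      show ?case
      proof
        assume x: "x \<in> ?W"
        show "1 \<le> v x"
        proof (cases "x \<in> G")
          case True
          then have "v3 x = 1" using elim by (simp add: v3_def unit_truncation_def)
          then show ?thesis using nn by (simp add: v_def)
        next
          case False
          then have "\<bar>y x\<bar> < d" "c < u x" "y x \<noteq> 0" using x elim c by auto
          then have "1 \<le> 2 / c * f x \<or> 1 \<le> - 2 / c * g x"
            unfolding f_def g_def
            using elim by (intro sign_conflict[of "q x" "y x" "z x" "w x" d s t c "u x"] w(2) z(2) d(2) c(1))
          then have "v1 x = 1 \<or> v2 x = 1" by (auto simp: v1_def v2_def unit_truncation_def)
          then show ?thesis using nn by (auto simp: v_def)
        qed
      qed
    qed
    have "capacity \<mu> V E ?A \<le> ennreal (E1 \<mu> E v v)"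
      by (rule capacity_leI[OF vV W _ one]) (use d(1) in auto)
    also have "\<dots> \<le> 0 + ennreal \<epsilon>" using vE by (simp add: ennreal_leI)
    finally show ?thesis .
  qed
  then have "capacity \<mu> V E ?A \<le> 0" by (rule ennreal_le_epsilon)
  then show ?thesis by simp
qed

section \<open>Bump functions\<close>

text \<open>A tent function of radius \<open>r / 2\<close>. Balls need not be relatively compact, so
  the radius is shrunk until the ball also lies in a neighborhood of \<open>x\<close> contained in a
  compact set.\<close>

lemma exists_bump_in_Cc:
  fixes x :: "'a::metric_space"
  assumes lc: "locally_compact_space (euclidean :: 'a topology)" and U: "open U" "x \<in> U"
  obtains f where "f \<in> Cc" "f x = 1" "\<And>p. 0 \<le> f p \<and> f p \<le> 1" "\<And>p. p \<notin> U \<Longrightarrow> f p = (0::real)"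
proof -
  obtain W K where WK: "open W" "compact K" "x \<in> W" "W \<subseteq> K"
    using lc unfolding locally_compact_space_def by simp blast
  have "open (U \<inter> W)" "x \<in> U \<inter> W" using U WK by auto
  then obtain r where r: "0 < r" "ball x r \<subseteq> U \<inter> W" by (meson open_contains_ball)
  define f where "f p = max 0 (1 - 2 / r * dist x p)" for p
  have fz: "f p = 0" if "r / 2 \<le> dist x p" for p using that r by (simp add: f_def field_simps)
  have "{p. f p \<noteq> 0} \<subseteq> cball x (r / 2)" 
  proof
    fix p assume "p \<in> {p. f p \<noteq> 0}"
    then show "p \<in> cball x (r / 2)" using fz[of p] by (cases "r / 2 \<le> dist x p") auto
  qed
  then have "closure {p. f p \<noteq> 0} \<subseteq> cball x (r / 2)" by (rule closure_minimal) simp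
  also have "\<dots> \<subseteq> ball x r" using r by auto
  finally have "closure {p. f p \<noteq> 0} \<subseteq> K" using r WK by blast
  then have "compact (closure {p. f p \<noteq> 0})"
    using compact_Int_closed[OF WK(2) closed_closure, of "{p. f p \<noteq> 0}"] by (simp add: Int_absorb1)
  moreover have "continuous_on UNIV f" unfolding f_def by (intro continuous_intros)
  ultimately have "f \<in> Cc" by (simp add: Cc_def)
  moreover have "f x = 1" by (simp add: f_def)
  moreover have "0 \<le> f p \<and> f p \<le> 1" for p using r by (simp add: f_def)
  moreover have "f p = 0" if "p \<notin> U" for p
  proof (rule fz)
    have "p \<notin> ball x r" using that r by blast
    then show "r / 2 \<le> dist x p" using r by simp
  qed
  ultimately show ?thesis by (rule that)
qed

text \<open>
  Subtracting a constant and taking the positive part pushes the support of the approximant into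
  \<open>U\<close>; for \<open>g \<le> 2\<close> this operation is a combination of unit truncations.
\<close>

lemma exists_bump_in_V:
  fixes x :: "'a::metric_space"
  assumes lc: "locally_compact_space (euclidean :: 'a topology)" and dir: "regular_dirichlet_space \<mu> V E"
    and U: "open U" "x \<in> U"
  obtains u where "u \<in> V" "continuous_on UNIV u" "1/4 < u x" "\<And>p. p \<notin> U \<Longrightarrow> u p = 0"
proof -
  interpret regular_dirichlet_space \<mu> V E by (rule dir)
  obtain f where f: "f \<in> Cc" "f x = 1" "\<And>p. 0 \<le> f p \<and> f p \<le> 1" "\<And>p. p \<notin> U \<Longrightarrow> f p = (0::real)"
    using exists_bump_in_Cc[OF lc U] by blast
  \<comment> \<open>With tolerance \<open>1/4\<close>, \<open>g\<close> stays below
    \<open>1/4\<close> off \<open>U\<close> and exceeds \<open>3/4\<close> at \<open>x\<close>, so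
    cutting at \<open>1/4\<close> leaves more than \<open>1/2\<close> at \<open>x\<close>.\<close>
  obtain g where g: "g \<in> V" "g \<in> Cc" "\<And>p. \<bar>f p - g p\<bar> < 1/4"
    using dense_in_Cc[OF f(1), of "1/4"] by auto
  have gc: "continuous_on UNIV g" using g by (simp add: Cc_def)
  define u where "u p = max 0 (g p - 1/4)" for p
  \<comment> \<open>The first term is the positive part of \<open>g\<close>, the second is that part
    capped at \<open>1/4\<close>.\<close>
  have u_eq: "u = (\<lambda>p. 2 * unit_truncation (\<lambda>p. 1/2 * g p) p - 1/4 * unit_truncation (\<lambda>p. 4 * g p) p)"
  proof
    fix p
    have "g p \<le> 2" using g(3)[of p] f(3)[of p] by (auto simp: abs_if split: if_splits)
    then show "u p = 2 * unit_truncation (\<lambda>p. 1/2 * g p) p - 1/4 * unit_truncation (\<lambda>p. 4 * g p) p"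
      by (auto simp: u_def unit_truncation_def min_def max_def)
  qed
  have "u \<in> V" unfolding u_eq by (intro H.diff_mem V_scale unit_truncation_mem g(1))
  moreover have "continuous_on UNIV u" unfolding u_def by (intro continuous_intros gc)
  moreover have "1/4 < u x" using g(3)[of x] f(2) by (auto simp: u_def abs_if split: if_splits)
  moreover have "u p = 0" if "p \<notin> U" for p
    using g(3)[of p] f(4)[OF that] by (auto simp: u_def abs_if split: if_splits)
  ultimately show ?thesis using that by blast
qed

section \<open>Localization on \<open>U\<close> and the contradiction\<close>

theorem theorem3p1:
  fixes \<mu> :: "'a::metric_space measure"
    and V :: "('a \<Rightarrow> real) set"
    and E :: "('a \<Rightarrow> real) \<Rightarrow> ('a \<Rightarrow> real) \<Rightarrow> real"
    and q y y_qc :: "'a \<Rightarrow> real"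
    and U :: "'a set"
  assumes "locally_compact_space (euclidean :: 'a topology)"
    and "separable_space (euclidean :: 'a topology)"
    and "sets \<mu> = sets borel"
    and "\<And>G. open G \<Longrightarrow> G \<noteq> {} \<Longrightarrow> emeasure \<mu> G > 0"
    and "\<And>K. compact K \<Longrightarrow> emeasure \<mu> K < \<infinity>"
    and "regular_dirichlet_space \<mu> V E"
    and "embeds_continuously_densely_L1 \<mu> V E"
    and "q \<in> M_set \<mu>"
    and "y \<in> V"
    and "bidual_embedding V (E1_norm \<mu> E) y
           \<in> normal_cone (V_dual \<mu> V E) (V_dual_norm \<mu> V E) (M_dual \<mu> V) (functional_of \<mu> V q)"
    and "quasi_continuous_rep \<mu> V E y y_qc"
    and "open U"
    and "emeasure \<mu> (U \<inter> {x. y_qc x = 0}) = 0"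
    and "capacity \<mu> V E (U \<inter> {x. y_qc x = 0}) > 0"
  shows "\<not> polyhedric_at (V_dual \<mu> V E) (V_dual_norm \<mu> V E) (M_dual \<mu> V) (functional_of \<mu> V q)
           (bidual_embedding V (E1_norm \<mu> E) y)"
proof
  assume poly: "polyhedric_at (V_dual \<mu> V E) (V_dual_norm \<mu> V E) (M_dual \<mu> V) (functional_of \<mu> V q)
           (bidual_embedding V (E1_norm \<mu> E) y)"
  interpret regular_dirichlet_space \<mu> V E by (rule assms(6))
  let ?Z = "{x. y_qc x = 0}"
  note emb = assms(7) and q = assms(8)
  have yN: "y \<in> normal_fns q" using normal_cone_imp_normal_fns[OF emb q assms(9,10)] .
  have qc: "y_qc \<in> borel_measurable borel" "AE x in \<mu>. y_qc x = y x"
    using assms(11) by (auto simp: quasi_continuous_rep_def)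
  \<comment> \<open>A null set must be measurable; Borel measurability of the representative ensures
    this for \<open>U \<inter> ?Z\<close>.\<close>
  have "?Z \<in> sets borel" using qc(1) by measurable
  then have "U \<inter> ?Z \<in> null_sets \<mu>" using assms(3,12,13) by (auto simp: null_sets_def)
  then have "AE x in \<mu>. x \<notin> U \<inter> ?Z" by (rule AE_not_in)
  then have y0: "AE x in \<mu>. x \<in> U \<longrightarrow> y x \<noteq> 0"
    using qc(2) by eventually_elim auto
  \<comment> \<open>Each point has a bump \<open>u\<close> whose level set above \<open>1/4\<close>
    is an open neighborhood. Both \<open>u\<close> and \<open>- u\<close> vanish off
    \<open>U\<close>, so polyhedricity approximates both and the sign conflict applies.\<close>
  have loc: "\<exists>S. open S \<and> x \<in> S \<and> capacity \<mu> V E (?Z \<inter> S) = 0" if x: "x \<in> U" for x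
  proof -
    obtain u where u: "u \<in> V" "continuous_on UNIV u" "1/4 < u x" "\<And>p. p \<notin> U \<Longrightarrow> u p = 0"
      using exists_bump_in_V[OF assms(1,6,12) x] by blast
    have "capacity \<mu> V E (?Z \<inter> {p. 1/4 < u p}) = 0"
    proof (rule capacity_zero_set_null[OF emb q yN assms(11) y0 u(1,2)])
      show "{p. 1/4 < u p} \<subseteq> U"
      proof
        fix p assume "p \<in> {p. 1/4 < u p}"
        then show "p \<in> U" using u(4)[of p] by (cases "p \<in> U") auto
      qed
    next
      fix \<epsilon> :: real assume e: "0 < \<epsilon>"
      show "\<exists>z\<in>normal_fns q. \<exists>t\<ge>0. E1_norm \<mu> E (\<lambda>x. u x - (z x - t * y x)) < \<epsilon>"
        by (rule polyhedric_imp_approximation[OF emb q yN y0 u(1) _ poly e]) (use u(4) in auto)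
      show "\<exists>z\<in>normal_fns q. \<exists>t\<ge>0. E1_norm \<mu> E (\<lambda>x. - u x - (z x - t * y x)) < \<epsilon>"
        by (rule polyhedric_imp_approximation[OF emb q yN y0 H.minus_mem[OF u(1)] _ poly e]) (use u(4) in auto)
    qed simp
    moreover have "open {p. 1/4 < u p}" by (intro open_Collect_less u continuous_intros)
    ultimately show ?thesis using u(3) by blast
  qed
  \<comment> \<open>The zero function is a test function for the empty set; this settles the base
    case of the countable cover.\<close>
  have "capacity \<mu> V E {} \<le> ennreal (E1 \<mu> E (\<lambda>x. 0) (\<lambda>x. 0))"
    by (rule capacity_leI[OF V_zero open_empty]) auto
  then have empty: "capacity \<mu> V E (?Z \<inter> {}) = 0" using H.B_zero[OF V_zero] by simp
  have down: "capacity \<mu> V E (?Z \<inter> S) = 0" if "S \<subseteq> T" "capacity \<mu> V E (?Z \<inter> T) = 0" for S T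
    using capacity_mono[of "?Z \<inter> S" "?Z \<inter> T" \<mu> V E] that by auto
  have "\<exists>A :: nat \<Rightarrow> 'a set. U \<subseteq> (\<Union>n. A n) \<and> (\<forall>n. capacity \<mu> V E (?Z \<inter> A n) = 0)"
    by (rule separable_countable_cover[OF assms(2)]) (rule loc down empty; assumption)+
  then obtain A :: "nat \<Rightarrow> 'a set" where A: "U \<subseteq> (\<Union>n. A n)" "\<And>n. capacity \<mu> V E (?Z \<inter> A n) = 0"
    by blast
  have "capacity \<mu> V E (U \<inter> ?Z) \<le> capacity \<mu> V E (\<Union>n. ?Z \<inter> A n)"
    using A(1) by (intro capacity_mono) blast
  also have "\<dots> = 0" using A(2) by (rule capacity_null_UN)
  finally show False using assms(14) by simp
qed

end
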